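(* Suppose there exist a continuously differentiable function $V:\mathbb{R}^{2n+q}\to\mathbb{R}$, positive reals $k,c_1,c_2,c_3$, and a neighborhood $\mathcal{U}\subset\mathbb{R}^{2n}$ of $0$ such that $c_1|x|_{\mathcal{A}}^k\le V(x)\le c_2|x|_{\mathcal{A}}^k$ for all $x\in\mathcal{C}$; $\langle\nabla V(x),f(x)\rangle\le-c_3V(x)$ for all $x\in\mathcal{U}\times\mathcal{T}$; and $V(g)-V(x)\le0$ for all $x\in\mathcal{D}$, $g\in G(x)$. Then the set $\mathcal{A}$ is exponentially stable for $\mathcal{H}_{cl}$. Moreover, the basin of attraction of $\mathcal{A}$ contains every sublevel set $\{x\in\mathcal{C}:V(x)\le c\}$ of the restriction of $V$ to $\mathcal{C}$ that is included in $\mathcal{U}\times\mathcal{T}$.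
   Context: Setting: integers $n,m\ge1$, $1\le q\le n$, $n_1,\dots,n_q\ge1$ with $\sum n_i=n$; $\mathcal{N}=\{1,\dots,q\}$; $A\in\mathbb{R}^{n\times n}$, $B\in\mathbb{R}^{n\times m}$, $K\in\mathbb{R}^{m\times n}$, $\bar u\in\mathbb{R}^m$ with $\bar u_i>0$; positive reals $T_1^{(i)}\le T_2^{(i)}$. $\mathfrak{sat}_{\bar u}(v)=(\operatorname{sat}_1(v_1),\dots,\operatorname{sat}_m(v_m))$, $\operatorname{sat}_i(s)=\min(|s|,\bar u_i)\operatorname{sign}(s)$, $\mathfrak{dz}_{\bar u}(y)=\mathfrak{sat}_{\bar u}(y)-y$; $A_{cl}=\begin{bmatrix}A+BK&-BK\\0&A\end{bmatrix}$, $B_{cl}=\begin{bmatrix}B\\0\end{bmatrix}$, $K_{cl}=[K\ \ -K]$. State $x=(x_p,\tilde\eta,\tau)\in\mathbb{R}^n\times\mathbb{R}^n\times\mathbb{R}^q$, $\bar x=(x_p,\tilde\eta)$, $\tilde\eta=(\tilde\eta^{(1)},\dots,\tilde\eta^{(q)})$, $\tilde\eta^{(i)}\in\mathbb{R}^{n_i}$; $\mathcal{T}=\prod_i[0,T_2^{(i)}]$. $\mathcal{H}_{cl}$: $\dot x=f(x)$ on $\mathcal{C}=\mathbb{R}^{2n}\times\mathcal{T}$ with $f(x)=(A_{cl}\bar x+B_{cl}\mathfrak{dz}_{\bar u}(K_{cl}\bar x),-\mathbf{1}_q)$; $x^+\in G(x)$ on $\mathcal{D}=\mathbb{R}^{2n}\times\bigcup_i\mathcal{D}_i$,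 $\mathcal{D}_i=\{\tau\in\mathcal{T}:\tau_i=0\}$, $G(x)=\bigcup_{i:\tau\in\mathcal{D}_i}\{x_p\}\times\{h_i(\tilde\eta)\}\times\widehat{\mathcal{G}}_i(\tau)$, where $h_i(\tilde\eta)$ replaces the block $\tilde\eta^{(i)}$ by $0$ and keeps the others, and $\widehat{\mathcal{G}}_i(\tau)=\{\chi\in\mathbb{R}^q:\chi_i\in[T_1^{(i)},T_2^{(i)}],\chi_k=\tau_k\ \forall k\ne i\}$. Solutions in the sense of Goebel–Sanfelice–Teel. $\mathcal{A}=\{0\}\times\mathcal{T}\subset\mathbb{R}^{2n}\times\mathbb{R}^q$, $|x|_{\mathcal{A}}$ distance to $\mathcal{A}$. $\mathcal{A}$ is exponentially stable if there exist $\kappa,\lambda,\mu>0$ such that every maximal solution $\phi$ with $|\phi(0,0)|_{\mathcal{A}}\le\mu$ is complete and $|\phi(t,j)|_{\mathcal{A}}\le\kappa e^{-\lambda(t+j)}|\phi(0,0)|_{\mathcal{A}}$ for all $(t,j)\in\operatorname{dom}\phi$; the basin of attraction is the set of points from which every maximal solution is complete and converges to $\mathcal{A}$. *)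

theory Defs
  imports "HOL-Analysis.Analysis"
begin

section \<open>Hybrid systems in the sense of Goebel--Sanfelice--Teel\<close>

definition compact_htd :: "(real \<times> nat) set \<Rightarrow> bool" where
  "compact_htd E \<longleftrightarrow> (\<exists>(J::nat) (ts::nat \<Rightarrow> real). ts 0 = 0 \<and> (\<forall>j\<le>J. ts j \<le> ts (Suc j)) \<and>
      E = (\<Union>j\<in>{0..J}. {ts j .. ts (Suc j)} \<times> {j}))"

definition htd :: "(real \<times> nat) set \<Rightarrow> bool" where
  "htd E \<longleftrightarrow> (0, 0) \<in> E \<and> E \<subseteq> {0..} \<times> UNIV \<and>
      (\<forall>T J. (T, J) \<in> E \<longrightarrow> compact_htd (E \<inter> ({0..T} \<times> {0..J})))"

definition tint :: "(real \<times> nat) set \<Rightarrow> nat \<Rightarrow> real set" where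
  "tint E j = {t. (t, j) \<in> E}"

definition abs_cont_on :: "real set \<Rightarrow> (real \<Rightarrow> 'a::real_normed_vector) \<Rightarrow> bool" where
  "abs_cont_on S g \<longleftrightarrow> (\<forall>\<epsilon>>0. \<exists>\<delta>>0. \<forall>(N::nat) (a::nat \<Rightarrow> real) (b::nat \<Rightarrow> real).
      (\<forall>k<N. a k \<le> b k \<and> a k \<in> S \<and> b k \<in> S) \<and> (\<forall>k. Suc k < N \<longrightarrow> b k \<le> a (Suc k)) \<and>
      (\<Sum>k<N. b k - a k) < \<delta> \<longrightarrow> (\<Sum>k<N. norm (g (b k) - g (a k))) < \<epsilon>)"

definition loc_abs_cont_on :: "real set \<Rightarrow> (real \<Rightarrow> 'a::real_normed_vector) \<Rightarrow> bool" where
  "loc_abs_cont_on I g \<longleftrightarrow> (\<forall>a b. a \<in> I \<longrightarrow> b \<in> I \<longrightarrow> abs_cont_on {a..b} g)"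

definition hybrid_arc :: "(real \<times> nat) set \<Rightarrow> (real \<times> nat \<Rightarrow> 'a::real_normed_vector) \<Rightarrow> bool" where
  "hybrid_arc E \<phi> \<longleftrightarrow> htd E \<and> (\<forall>j. loc_abs_cont_on (tint E j) (\<lambda>t. \<phi> (t, j)))"

definition is_solution ::
  "'a set \<Rightarrow> ('a \<Rightarrow> 'a) \<Rightarrow> 'a set \<Rightarrow> ('a \<Rightarrow> 'a set) \<Rightarrow>
   (real \<times> nat) set \<Rightarrow> (real \<times> nat \<Rightarrow> 'a::real_normed_vector) \<Rightarrow> bool" where
  "is_solution C f D G E \<phi> \<longleftrightarrow>
     hybrid_arc E \<phi> \<and>
     \<phi> (0, 0) \<in> closure C \<union> D \<and>
     (\<forall>j. interior (tint E j) \<noteq> {} \<longrightarrow>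
        (\<forall>t\<in>interior (tint E j). \<phi> (t, j) \<in> C) \<and>
        (AE t in lebesgue. t \<in> tint E j \<longrightarrow>
           ((\<lambda>s. \<phi> (s, j)) has_vector_derivative f (\<phi> (t, j))) (at t within tint E j))) \<and>
     (\<forall>t j. (t, j) \<in> E \<longrightarrow> (t, Suc j) \<in> E \<longrightarrow> \<phi> (t, j) \<in> D \<and> \<phi> (t, Suc j) \<in> G (\<phi> (t, j)))"

definition maximal_solution ::
  "'a set \<Rightarrow> ('a \<Rightarrow> 'a) \<Rightarrow> 'a set \<Rightarrow> ('a \<Rightarrow> 'a set) \<Rightarrow>
   (real \<times> nat) set \<Rightarrow> (real \<times> nat \<Rightarrow> 'a::real_normed_vector) \<Rightarrow> bool" where
  "maximal_solution C f D G E \<phi> \<longleftrightarrow> is_solution C f D G E \<phi> \<and>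
     \<not> (\<exists>E' \<phi>'. is_solution C f D G E' \<phi>' \<and> E \<subset> E' \<and> (\<forall>p\<in>E. \<phi>' p = \<phi> p))"

definition complete_dom :: "(real \<times> nat) set \<Rightarrow> bool" where
  "complete_dom E \<longleftrightarrow> (\<forall>M. \<exists>(t, j)\<in>E. t + real j \<ge> M)"

definition exp_stable ::
  "'a set \<Rightarrow> ('a \<Rightarrow> 'a) \<Rightarrow> 'a set \<Rightarrow> ('a \<Rightarrow> 'a set) \<Rightarrow> 'a::real_normed_vector set \<Rightarrow> bool" where
  "exp_stable C f D G \<A> \<longleftrightarrow> (\<exists>\<kappa> lam \<mu>. \<kappa> > 0 \<and> lam > 0 \<and> \<mu> > 0 \<and>
     (\<forall>E \<phi>. maximal_solution C f D G E \<phi> \<and> infdist (\<phi> (0, 0)) \<A> \<le> \<mu> \<longrightarrow>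
        complete_dom E \<and>
        (\<forall>t j. (t, j) \<in> E \<longrightarrow>
           infdist (\<phi> (t, j)) \<A> \<le> \<kappa> * exp (- lam * (t + real j)) * infdist (\<phi> (0, 0)) \<A>)))"

definition basin ::
  "'a set \<Rightarrow> ('a \<Rightarrow> 'a) \<Rightarrow> 'a set \<Rightarrow> ('a \<Rightarrow> 'a set) \<Rightarrow> 'a::real_normed_vector set \<Rightarrow> 'a set" where
  "basin C f D G \<A> = {\<xi>. \<forall>E \<phi>. maximal_solution C f D G E \<phi> \<and> \<phi> (0, 0) = \<xi> \<longrightarrow>
      complete_dom E \<and>
      (\<forall>\<epsilon>>0. \<exists>M. \<forall>t j. (t, j) \<in> E \<and> t + real j \<ge> M \<longrightarrow> infdist (\<phi> (t, j)) \<A> < \<epsilon>)}"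

text \<open>State x = ((x_p, eta), tau) with x_p, eta in R^n and tau in R^q.\<close>

definition sat1 :: "real \<Rightarrow> real \<Rightarrow> real" where
  "sat1 u s = min \<bar>s\<bar> u * sgn s"

definition satv :: "real^'m \<Rightarrow> real^'m \<Rightarrow> real^'m" where
  "satv ub v = (\<chi> i. sat1 (ub $ i) (v $ i))"

definition dzv :: "real^'m \<Rightarrow> real^'m \<Rightarrow> real^'m" where
  "dzv ub y = satv ub y - y"

text \<open>Block matrices A_cl, B_cl, K_cl, written as their actions.\<close>
definition Acl :: "real^'n^'n \<Rightarrow> real^'m^'n \<Rightarrow> real^'n^'m \<Rightarrow> (real^'n) \<times> (real^'n) \<Rightarrow> (real^'n) \<times> (real^'n)" where
  "Acl A B K xb = ((A + B ** K) *v fst xb - (B ** K) *v snd xb, A *v snd xb)"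

definition Bcl :: "real^'m^'n \<Rightarrow> real^'m \<Rightarrow> (real^'n) \<times> (real^'n)" where
  "Bcl B u = (B *v u, 0)"

definition Kcl :: "real^'n^'m \<Rightarrow> (real^'n) \<times> (real^'n) \<Rightarrow> real^'m" where
  "Kcl K xb = K *v fst xb - K *v snd xb"

definition Tset :: "real^'q \<Rightarrow> (real^'q) set" where
  "Tset T2 = {\<tau>. \<forall>i. 0 \<le> \<tau> $ i \<and> \<tau> $ i \<le> T2 $ i}"

definition Ccl :: "real^'q \<Rightarrow> (((real^'n) \<times> (real^'n)) \<times> (real^'q)) set" where
  "Ccl T2 = UNIV \<times> Tset T2"

definition fcl :: "real^'n^'n \<Rightarrow> real^'m^'n \<Rightarrow> real^'n^'m \<Rightarrow> real^'m \<Rightarrow>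
    ((real^'n) \<times> (real^'n)) \<times> (real^'q) \<Rightarrow> ((real^'n) \<times> (real^'n)) \<times> (real^'q)" where
  "fcl A B K ub x = (Acl A B K (fst x) + Bcl B (dzv ub (Kcl K (fst x))), (\<chi> i. - 1))"

definition Dset :: "real^'q \<Rightarrow> 'q \<Rightarrow> (real^'q) set" where
  "Dset T2 i = {\<tau> \<in> Tset T2. \<tau> $ i = 0}"

definition Dcl :: "real^'q \<Rightarrow> (((real^'n) \<times> (real^'n)) \<times> (real^'q)) set" where
  "Dcl T2 = UNIV \<times> (\<Union>i. Dset T2 i)"

text \<open>blk k = index of the block of eta containing coordinate k; h_i resets block i to zero.\<close>
definition hreset :: "('n \<Rightarrow> 'q) \<Rightarrow> 'q \<Rightarrow> real^'n \<Rightarrow> real^'n" where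
  "hreset blk i \<eta> = (\<chi> k. if blk k = i then 0 else \<eta> $ k)"

definition Ghat :: "real^'q \<Rightarrow> real^'q \<Rightarrow> 'q \<Rightarrow> real^'q \<Rightarrow> (real^'q) set" where
  "Ghat T1 T2 i \<tau> = {w. T1 $ i \<le> w $ i \<and> w $ i \<le> T2 $ i \<and> (\<forall>k. k \<noteq> i \<longrightarrow> w $ k = \<tau> $ k)}"

definition Gcl :: "('n \<Rightarrow> 'q) \<Rightarrow> real^'q \<Rightarrow> real^'q \<Rightarrow>
    ((real^'n) \<times> (real^'n)) \<times> (real^'q) \<Rightarrow> (((real^'n) \<times> (real^'n)) \<times> (real^'q)) set" where
  "Gcl blk T1 T2 x = (\<Union>i\<in>{i. snd x \<in> Dset T2 i}.
      ({fst (fst x)} \<times> {hreset blk i (snd (fst x))}) \<times> Ghat T1 T2 i (snd x))"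

definition Acl_set :: "real^'q \<Rightarrow> (((real^'n) \<times> (real^'n)) \<times> (real^'q)) set" where
  "Acl_set T2 = {0} \<times> Tset T2"

end

theory Submission
  imports Defs
begin

text \<open>
  Along a flow contained in a sublevel set, \<open>exp (c3 * t) * V\<close> is absolutely continuous with
  nonpositive derivative almost everywhere, and \<open>V\<close> does not increase at jumps; hence \<open>V\<close> decays like
  \<open>exp (- c3 * t)\<close>. Decay in \<open>t + j\<close> follows from a dwell-time bound: \<open>\<Sum>i. \<tau>\<^sub>i / T1\<^sub>i\<close> decreases at a
  constant rate during flows and grows by at least one at every jump, so \<open>j\<close> is bounded by an affine
  function of \<open>t\<close>. A maximal solution that stays in a bounded set is complete, since otherwise it could
  be prolonged by a jump (some timer is zero), by a flow (all timers are positive and the vector field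
  is Lipschitz), or by its limit at an open right end.
\<close>

section \<open>Absolutely continuous curves\<close>

definition interval_chain :: "real set \<Rightarrow> (real \<times> real) list \<Rightarrow> bool" where
  "interval_chain S xs \<longleftrightarrow> (\<forall>(p, q)\<in>set xs. p \<le> q \<and> p \<in> S \<and> q \<in> S) \<and> successively (\<lambda>x y. snd x \<le> fst y) xs"

definition chain_length :: "(real \<times> real) list \<Rightarrow> real" where
  "chain_length xs = (\<Sum>(p, q)\<leftarrow>xs. q - p)"

definition chain_variation :: "(real \<Rightarrow> 'a::real_normed_vector) \<Rightarrow> (real \<times> real) list \<Rightarrow> real" where
  "chain_variation g xs = (\<Sum>(p, q)\<leftarrow>xs. norm (g q - g p))"

lemma interval_chain_simps [simp]:
  "interval_chain S []"
  "interval_chain S [(p, q)] \<longleftrightarrow> p \<le> q \<and> p \<in> S \<and> q \<in> S"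
  by (auto simp: interval_chain_def)

lemma chain_length_simps [simp]:
  "chain_length [] = 0" "chain_length ((p, q) # xs) = q - p + chain_length xs"
  "chain_length (xs @ ys) = chain_length xs + chain_length ys"
  by (simp_all add: chain_length_def)

lemma chain_variation_simps [simp]:
  "chain_variation g [] = 0" "chain_variation g ((p, q) # xs) = norm (g q - g p) + chain_variation g xs"
  "chain_variation g (xs @ ys) = chain_variation g xs + chain_variation g ys"
  by (simp_all add: chain_variation_def)

lemma interval_chain_append:
  assumes "interval_chain {a..b} xs" "interval_chain {b..c} ys" "a \<le> b" "b \<le> c"
  shows "interval_chain {a..c} (xs @ ys)"
proof -
  have "snd (last xs) \<le> fst (hd ys)" if "xs \<noteq> []" "ys \<noteq> []"
    using assms(1,2) last_in_set[OF that(1)] hd_in_set[OF that(2)]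
    by (fastforce simp: interval_chain_def)
  then show ?thesis
    using assms by (fastforce simp: interval_chain_def successively_append_iff)
qed

lemma interval_chain_subset: "interval_chain S xs \<Longrightarrow> S \<subseteq> R \<Longrightarrow> interval_chain R xs"
  by (auto simp: interval_chain_def)

lemma interval_chain_map_mono:
  assumes "interval_chain S xs" "mono h" "h ` S \<subseteq> R"
  shows "interval_chain R (map (map_prod h h) xs)"
  using assms unfolding interval_chain_def successively_map
  by (auto simp: image_subset_iff elim!: successively_mono dest: monoD)

lemma abs_cont_on_iff:
  "abs_cont_on S g \<longleftrightarrow> (\<forall>e>0. \<exists>d>0. \<forall>xs. interval_chain S xs \<and> chain_length xs < d \<longrightarrow> chain_variation g xs < e)"
proof -
  have sequence_iff_list:
    "(\<forall>(N::nat) a b. (\<forall>k<N. a k \<le> b k \<and> a k \<in> S \<and> b k \<in> S) \<and> (\<forall>k. Suc k < N \<longrightarrow> b k \<le> a (Suc k)) \<and>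
        (\<Sum>k<N. b k - a k) < d \<longrightarrow> (\<Sum>k<N. norm (g (b k) - g (a k))) < e) \<longleftrightarrow>
     (\<forall>xs. interval_chain S xs \<and> chain_length xs < d \<longrightarrow> chain_variation g xs < e)"
    (is "(\<forall>N a b. ?P N a b) \<longleftrightarrow> (\<forall>xs. ?Q xs)") for d e
  proof (intro iffI allI)
    fix xs assume "\<forall>N a b. ?P N a b"
    then have "?P (length xs) (\<lambda>k. fst (xs ! k)) (\<lambda>k. snd (xs ! k))" by (elim allE)
    then show "?Q xs"
      by (auto simp: interval_chain_def chain_length_def chain_variation_def sum_list_sum_nth
          atLeast0LessThan case_prod_unfold successively_conv_nth)
  next
    fix N :: nat and a b :: "nat \<Rightarrow> real" assume "\<forall>xs. ?Q xs"
    then have "?Q (map (\<lambda>k. (a k, b k)) [0..<N])" by (rule spec)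
    then show "?P N a b"
      by (auto simp: interval_chain_def chain_length_def chain_variation_def sum_list_sum_nth
          atLeast0LessThan successively_conv_nth)
  qed
  show ?thesis unfolding abs_cont_on_def sequence_iff_list ..
qed

lemma abs_cont_onE:
  assumes "abs_cont_on S g" "e > 0"
  obtains d where "d > 0" "\<And>xs. interval_chain S xs \<Longrightarrow> chain_length xs < d \<Longrightarrow> chain_variation g xs < e"
  using assms unfolding abs_cont_on_iff by blast

lemma abs_cont_on_subset: "abs_cont_on S g \<Longrightarrow> R \<subseteq> S \<Longrightarrow> abs_cont_on R g"
  unfolding abs_cont_on_iff by (meson interval_chain_subset)

lemma abs_cont_on_dominated:
  assumes g: "abs_cont_on S g" and "M > 0"
    and dominated: "\<And>u v. u \<in> S \<Longrightarrow> v \<in> S \<Longrightarrow> u \<le> v \<Longrightarrow> norm (h v - h u) \<le> M * (norm (g v - g u) + (v - u))"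
  shows "abs_cont_on S h"
  unfolding abs_cont_on_iff
proof (intro allI impI)
  fix e :: real assume "e > 0"
  with \<open>M > 0\<close> have e_scaled: "e / (2 * M) > 0" by simp
  obtain d where d: "d > 0"
    "\<And>xs. interval_chain S xs \<Longrightarrow> chain_length xs < d \<Longrightarrow> chain_variation g xs < e / (2 * M)"
    using abs_cont_onE[OF g e_scaled] by blast
  have "chain_variation h xs < e" if xs: "interval_chain S xs" "chain_length xs < min d (e / (2 * M))" for xs
  proof -
    have "chain_variation h xs \<le> (\<Sum>(p, q)\<leftarrow>xs. M * (norm (g q - g p) + (q - p)))"
      unfolding chain_variation_def using xs(1)
      by (intro sum_list_mono) (auto simp: interval_chain_def intro: dominated)
    also have "\<dots> = M * (chain_variation g xs + chain_length xs)"
      by (induction xs) (auto simp: algebra_simps)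
    also have "\<dots> < M * (e / (2 * M) + e / (2 * M))"
      using xs d(2)[of xs] \<open>M > 0\<close> by (intro mult_strict_left_mono add_strict_mono) auto
    also have "\<dots> = e" using \<open>M > 0\<close> by simp
    finally show ?thesis .
  qed
  then show "\<exists>d>0. \<forall>xs. interval_chain S xs \<and> chain_length xs < d \<longrightarrow> chain_variation h xs < e"
    using d(1) e_scaled by (intro exI[of _ "min d (e / (2 * M))"]) simp
qed

lemma abs_cont_on_const: "abs_cont_on S (\<lambda>_. c)"
  unfolding abs_cont_on_iff by (auto simp: chain_variation_def case_prod_unfold intro: exI[of _ 1])

lemma lipschitz_imp_abs_cont_on:
  assumes "M-lipschitz_on S h"
  shows "abs_cont_on S h"
proof (rule abs_cont_on_dominated[OF abs_cont_on_const])
  show "M + 1 > 0" using lipschitz_on_nonneg[OF assms] by simp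
  show "norm (h v - h u) \<le> (M + 1) * (norm (0 - 0::real) + (v - u))"
    if "u \<in> S" "v \<in> S" "u \<le> v" for u v
    using lipschitz_onD[OF assms, of v u] that by (simp add: dist_norm algebra_simps)
qed

lemma abs_cont_on_imp_continuous_on:
  assumes "abs_cont_on S g"
  shows "continuous_on S g"
  unfolding continuous_on_iff
proof (intro ballI allI impI)
  fix x e :: real assume x: "x \<in> S" and "e > 0"
  then obtain d where d: "d > 0" "\<And>xs. interval_chain S xs \<Longrightarrow> chain_length xs < d \<Longrightarrow> chain_variation g xs < e"
    using abs_cont_onE[OF assms] by metis
  have "dist (g y) (g x) < e" if "y \<in> S" "dist y x < d" for y
    using d(2)[of "[(min x y, max x y)]"] that x
    by (cases "x \<le> y") (auto simp: dist_norm norm_minus_commute)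
  then show "\<exists>d>0. \<forall>y\<in>S. dist y x < d \<longrightarrow> dist (g y) (g x) < e" using d(1) by blast
qed

lemma abs_cont_on_shift:
  assumes "abs_cont_on {a..b} g"
  shows "abs_cont_on {a + s..b + s} (\<lambda>t. g (t - s))"
  unfolding abs_cont_on_iff
proof (intro allI impI)
  fix e :: real assume "e > 0"
  then obtain d where d: "d > 0"
    "\<And>xs. interval_chain {a..b} xs \<Longrightarrow> chain_length xs < d \<Longrightarrow> chain_variation g xs < e"
    using abs_cont_onE[OF assms] by metis
  define shift where "shift = map (map_prod (\<lambda>t. t - s) (\<lambda>t. t - s))"
  have "chain_length (shift xs) = chain_length xs" for xs
    by (induction xs) (auto simp: shift_def)
  moreover have "chain_variation (\<lambda>t. g (t - s)) xs = chain_variation g (shift xs)" for xs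
    by (induction xs) (auto simp: shift_def)
  moreover have "interval_chain {a..b} (shift xs)" if "interval_chain {a + s..b + s} xs" for xs
    unfolding shift_def by (rule interval_chain_map_mono[OF that]) (auto intro: monoI)
  ultimately show "\<exists>d>0. \<forall>xs. interval_chain {a + s..b + s} xs \<and> chain_length xs < d \<longrightarrow>
      chain_variation (\<lambda>t. g (t - s)) xs < e"
    using d by (intro exI[of _ d]) simp
qed

lemma chain_variation_concat_le:
  assumes ordered: "\<forall>(p, q)\<in>set xs. p \<le> q" and "g b = h b"
  shows "chain_variation (\<lambda>t. if t \<le> b then g t else h t) xs \<le>
    chain_variation g (map (map_prod (min b) (min b)) xs) +
    chain_variation h (map (map_prod (max b) (max b)) xs)"
proof -
  define gh where "gh t = (if t \<le> b then g t else h t)" for t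
  have "norm (gh q - gh p) \<le> norm (g (min b q) - g (min b p)) + norm (h (max b q) - h (max b p))"
    if "p \<le> q" for p q
  proof -
    consider "q \<le> b" | "p \<le> b" "b < q" | "b < p" by linarith
    then show ?thesis
      using that \<open>g b = h b\<close> norm_triangle_ineq[of "g b - g p" "h q - h b"]
      by cases (simp_all add: gh_def min_absorb1 min_absorb2 max_absorb1 max_absorb2)
  qed
  then have "chain_variation gh xs \<le>
      chain_variation g (map (map_prod (min b) (min b)) xs) +
      chain_variation h (map (map_prod (max b) (max b)) xs)"
    unfolding chain_variation_def map_map o_def sum_list_addf[symmetric] using ordered
    by (intro sum_list_mono) auto
  then show ?thesis unfolding gh_def .
qed

lemma abs_cont_on_concat:
  assumes g: "abs_cont_on {a..b} g" and h: "abs_cont_on {b..c} h" and "g b = h b" and "a \<le> b" "b \<le> c"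
  shows "abs_cont_on {a..c} (\<lambda>t. if t \<le> b then g t else h t)"
  unfolding abs_cont_on_iff
proof (intro allI impI)
  fix e :: real assume "e > 0"
  then have half_pos: "e / 2 > 0" by simp
  obtain d where d: "d > 0"
    "\<And>xs. interval_chain {a..b} xs \<Longrightarrow> chain_length xs < d \<Longrightarrow> chain_variation g xs < e / 2"
    using abs_cont_onE[OF g half_pos] by blast
  obtain d' where d': "d' > 0"
    "\<And>xs. interval_chain {b..c} xs \<Longrightarrow> chain_length xs < d' \<Longrightarrow> chain_variation h xs < e / 2"
    using abs_cont_onE[OF h half_pos] by blast
  define left where "left = map (map_prod (min b) (min b))"
  define right where "right = map (map_prod (max b) (max b))"
  have "chain_variation (\<lambda>t. if t \<le> b then g t else h t) xs < e"
    if xs: "interval_chain {a..c} xs" "chain_length xs < min d d'" for xs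
  proof -
    have ordered: "\<forall>(p, q)\<in>set xs. p \<le> q" using xs(1) by (auto simp: interval_chain_def)
    have "interval_chain {a..b} (left xs)" "interval_chain {b..c} (right xs)"
      unfolding left_def right_def using \<open>a \<le> b\<close> \<open>b \<le> c\<close>
      by (auto intro!: interval_chain_map_mono[OF xs(1)] monoI)
    moreover have "chain_length (left xs) \<le> chain_length xs" "chain_length (right xs) \<le> chain_length xs"
      using ordered by (induction xs) (auto simp: left_def right_def)
    ultimately have "chain_variation g (left xs) < e / 2" "chain_variation h (right xs) < e / 2"
      using d(2) d'(2) xs(2) by auto
    then show ?thesis
      using chain_variation_concat_le[of xs g b h] ordered \<open>g b = h b\<close> unfolding left_def right_def by simp
  qed
  then show "\<exists>d>0. \<forall>xs. interval_chain {a..c} xs \<and> chain_length xs < d \<longrightarrow>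
      chain_variation (\<lambda>t. if t \<le> b then g t else h t) xs < e"
    using d(1) d'(1) by (intro exI[of _ "min d d'"]) simp
qed

lemma null_set_open_cover:
  assumes "Y \<in> null_sets lebesgue" "d > 0"
  obtains W where "open W" "Y \<subseteq> W" "W \<in> lmeasurable" "measure lebesgue W < d"
proof -
  obtain W where W: "open W" "Y \<subseteq> W" "W - Y \<in> lmeasurable" "emeasure lebesgue (W - Y) < ennreal d"
    using sets_lebesgue_outer_open[of Y d] assms by (auto simp: null_sets_def)
  have "W = (W - Y) \<union> Y" using W(2) by auto
  then have W_eq: "W \<in> lmeasurable" "emeasure lebesgue W = emeasure lebesgue (W - Y)"
    using assms(1) W(3)
    by (metis fmeasurable.Un fmeasurableI_null_sets, metis emeasure_Un_null_set fmeasurableD)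
  then have "measure lebesgue W < d"
    using W(4) assms(2) by (metis emeasure_eq_measure2 ennreal_less_iff measure_nonneg)
  then show ?thesis using that W(1,2) W_eq(1) by blast
qed

lemma measure_lebesgue_Int_adjacent:
  fixes u v w :: real
  assumes "open W" "u \<le> v" "v \<le> w"
  shows "measure lebesgue (W \<inter> {u<..<v}) + measure lebesgue (W \<inter> {v<..<w}) \<le> measure lebesgue (W \<inter> {u<..<w})"
proof -
  have lmeasurable: "W \<inter> {s<..<t} \<in> lmeasurable" for s t
    by (intro lmeasurable_open bounded_Int open_Int assms) auto
  have "(W \<inter> {u<..<v}) \<inter> (W \<inter> {v<..<w}) = {}" by auto
  then have "measure lebesgue (W \<inter> {u<..<v}) + measure lebesgue (W \<inter> {v<..<w})
      = measure lebesgue ((W \<inter> {u<..<v}) \<union> (W \<inter> {v<..<w}))"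
    using measure_Un2[OF lmeasurable lmeasurable, of u v v w] by (simp add: Diff_triv Int_commute)
  also have "\<dots> \<le> measure lebesgue (W \<inter> {u<..<w})"
    using lmeasurable assms(2,3) by (intro measure_mono_fmeasurable) (auto intro: fmeasurableD)
  finally show ?thesis .
qed

lemma nonpos_derivative_local_increment:
  fixes g :: "real \<Rightarrow> real"
  assumes "(g has_real_derivative D) (at x)" "D \<le> 0" "e > 0"
  obtains r where "r > 0" "\<And>u v. u \<le> x \<Longrightarrow> x \<le> v \<Longrightarrow> v - u < r \<Longrightarrow> g v - g u \<le> e * (v - u)"
proof -
  obtain r where r: "r > 0" "\<And>y. norm (y - x) < r \<Longrightarrow> norm (g y - g x - D * (y - x)) \<le> e * norm (y - x)"
    using assms(1,3) unfolding has_field_derivative_def has_derivative_at_alt by blast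
  have "g v - g u \<le> e * (v - u)" if "u \<le> x" "x \<le> v" "v - u < r" for u v
  proof -
    have "g v - g x \<le> D * (v - x) + e * (v - x)" "g x - g u \<le> D * (x - u) + e * (x - u)"
      using r(2)[of v] r(2)[of u] that by (auto simp: abs_le_iff algebra_simps)
    moreover have "D * (v - x) \<le> 0" "D * (x - u) \<le> 0"
      using assms(2) that by (auto intro: mult_nonpos_nonneg)
    ultimately show ?thesis by (simp add: algebra_simps)
  qed
  then show ?thesis using that r(1) by blast
qed

text \<open>Cousin's argument: the exceptional null set has a small open cover \<open>W\<close>. Points off \<open>W\<close>
  contribute at most \<open>e * length\<close>, and absolute continuity controls the increments inside \<open>W\<close>.\<close>

definition covered_increment :: "real set \<Rightarrow> real \<Rightarrow> (real \<Rightarrow> real) \<Rightarrow> real \<Rightarrow> real \<Rightarrow> bool" where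
  "covered_increment W e g u v \<longleftrightarrow>
     (\<exists>xs. interval_chain {u..v} xs \<and> chain_length xs \<le> measure lebesgue (W \<inter> {u<..<v}) \<and>
       g v - g u \<le> e * (v - u) + chain_variation g xs)"

lemma covered_increment_trans:
  assumes "open W" "covered_increment W e g u v" "covered_increment W e g v w" "u \<le> v" "v \<le> w"
  shows "covered_increment W e g u w"
proof -
  obtain xs ys where
    xs: "interval_chain {u..v} xs" "chain_length xs \<le> measure lebesgue (W \<inter> {u<..<v})"
      "g v - g u \<le> e * (v - u) + chain_variation g xs" and
    ys: "interval_chain {v..w} ys" "chain_length ys \<le> measure lebesgue (W \<inter> {v<..<w})"
      "g w - g v \<le> e * (w - v) + chain_variation g ys"
    using assms(2,3) unfolding covered_increment_def by blast
  show ?thesis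
    unfolding covered_increment_def
  proof (intro exI[of _ "xs @ ys"] conjI)
    show "interval_chain {u..w} (xs @ ys)"
      using xs(1) ys(1) assms(4,5) by (rule interval_chain_append)
    show "chain_length (xs @ ys) \<le> measure lebesgue (W \<inter> {u<..<w})"
      using xs(2) ys(2) measure_lebesgue_Int_adjacent[OF assms(1,4,5)] by simp
    show "g w - g u \<le> e * (w - u) + chain_variation g (xs @ ys)"
      using xs(3) ys(3) by (simp add: algebra_simps)
  qed
qed

lemma covered_increment_subset:
  assumes "u \<le> v" "{u<..<v} \<subseteq> W" "e \<ge> 0"
  shows "covered_increment W e g u v"
proof -
  have "W \<inter> {u<..<v} = {u<..<v}" using assms(2) by auto
  moreover have "g v - g u \<le> e * (v - u) + norm (g v - g u)"
    using assms(1,3) by (simp add: add_increasing)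
  ultimately show ?thesis
    using assms(1) by (auto simp: covered_increment_def intro!: exI[of _ "[(u, v)]"])
qed

lemma covered_increment_empty_chain: "g v - g u \<le> e * (v - u) \<Longrightarrow> covered_increment W e g u v"
  by (auto simp: covered_increment_def intro: exI[of _ "[]"])

lemma nonpos_derivative_covered_increment:
  assumes "open W" "a \<le> b" "e > 0"
    and deriv: "\<And>x. x \<in> {a..b} - W \<Longrightarrow> \<exists>D\<le>0. (g has_real_derivative D) (at x)"
  shows "covered_increment W e g a b"
  using \<open>a \<le> b\<close>
proof (induction rule: Bolzano)
  case (trans u v w)
  then show ?case using covered_increment_trans[OF \<open>open W\<close>] by blast
next
  case (local x)
  show ?case
  proof (cases "x \<in> W")
    case True
    then obtain r where r: "r > 0" "ball x r \<subseteq> W" using \<open>open W\<close> open_contains_ball by blast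
    have "{u<..<v} \<subseteq> W" if "u \<le> x" "x \<le> v" "v - u < r" for u v
      using r(2) that by (auto simp: subset_eq dist_real_def)
    then show ?thesis
      using \<open>e > 0\<close> by (intro exI[of _ r] conjI r(1) allI impI covered_increment_subset) auto
  next
    case False
    then obtain D where "D \<le> 0" "(g has_real_derivative D) (at x)" using deriv[of x] local by auto
    then obtain r where "r > 0" "\<And>u v. u \<le> x \<Longrightarrow> x \<le> v \<Longrightarrow> v - u < r \<Longrightarrow> g v - g u \<le> e * (v - u)"
      using nonpos_derivative_local_increment \<open>e > 0\<close> by metis
    then show ?thesis by (intro exI[of _ r] conjI allI impI covered_increment_empty_chain) auto
  qed
qed

lemma abs_cont_on_nonincreasing:
  fixes g :: "real \<Rightarrow> real"
  assumes abs_cont: "abs_cont_on {a..b} g" and "a \<le> b"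
    and deriv: "AE t in lebesgue. t \<in> {a<..<b} \<longrightarrow> (\<exists>D\<le>0. (g has_real_derivative D) (at t))"
  shows "g b \<le> g a"
proof -
  obtain Z where Z: "Z \<in> null_sets lebesgue"
    "\<And>t. t \<notin> Z \<Longrightarrow> t \<in> {a<..<b} \<longrightarrow> (\<exists>D\<le>0. (g has_real_derivative D) (at t))"
    using AE_E3[OF deriv] by (metis DiffI UNIV_I space_completion space_lborel space_borel)
  define Y where "Y = insert a (insert b Z)"
  have Y: "Y \<in> null_sets lebesgue" "\<And>t. t \<in> {a..b} - Y \<Longrightarrow> \<exists>D\<le>0. (g has_real_derivative D) (at t)"
    unfolding Y_def using Z by (auto simp: negligible_iff_null_sets[symmetric] negligible_insert)
  have increment: "g b - g a \<le> e * (b - a) + e" if "e > 0" for e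
  proof -
    obtain d where d: "d > 0" "\<And>xs. interval_chain {a..b} xs \<Longrightarrow> chain_length xs < d \<Longrightarrow> chain_variation g xs < e"
      using abs_cont_onE[OF abs_cont \<open>e > 0\<close>] by blast
    obtain W where W: "open W" "Y \<subseteq> W" "W \<in> lmeasurable" "measure lebesgue W < d"
      using null_set_open_cover[OF Y(1) d(1)] .
    have "covered_increment W e g a b"
      using W(2) Y(2) by (intro nonpos_derivative_covered_increment W(1) \<open>a \<le> b\<close> \<open>e > 0\<close>) auto
    then obtain xs where xs: "interval_chain {a..b} xs" "chain_length xs \<le> measure lebesgue (W \<inter> {a<..<b})"
      "g b - g a \<le> e * (b - a) + chain_variation g xs"
      unfolding covered_increment_def by blast
    have "measure lebesgue (W \<inter> {a<..<b}) \<le> measure lebesgue W"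
      using W(1,3) by (intro measure_mono_fmeasurable) auto
    then have "chain_variation g xs < e" using d(2)[OF xs(1)] xs(2) W(4) by simp
    then show ?thesis using xs(3) by simp
  qed
  have "g b - g a \<le> 0"
  proof (rule field_le_epsilon)
    fix e :: real assume "e > 0"
    define e' where "e' = e / (b - a + 1)"
    have "e' * (b - a) + e' = e' * (b - a + 1)" by (simp add: distrib_left)
    also have "\<dots> = e" using \<open>a \<le> b\<close> by (simp add: e'_def)
    finally show "g b - g a \<le> 0 + e"
      using increment[of e'] \<open>a \<le> b\<close> \<open>e > 0\<close> by (simp add: e'_def)
  qed
  then show ?thesis by simp
qed

lemma abs_cont_on_compose_lipschitz:
  assumes "abs_cont_on S g" and lip: "M-lipschitz_on (g ` S) h"
  shows "abs_cont_on S (\<lambda>t. h (g t))"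
proof (rule abs_cont_on_dominated[OF assms(1)])
  show "M + 1 > 0" using lipschitz_on_nonneg[OF lip] by simp
  show "norm (h (g v) - h (g u)) \<le> (M + 1) * (norm (g v - g u) + (v - u))" if "u \<in> S" "v \<in> S" "u \<le> v" for u v
  proof -
    have "norm (h (g v) - h (g u)) \<le> M * norm (g v - g u)"
      using lipschitz_onD[OF lip, of "g v" "g u"] that by (simp add: dist_norm)
    also have "\<dots> \<le> (M + 1) * (norm (g v - g u) + (v - u))"
      using that lipschitz_on_nonneg[OF lip] by (intro mult_mono) auto
    finally show ?thesis .
  qed
qed

lemma abs_cont_on_graph:
  assumes "abs_cont_on S g"
  shows "abs_cont_on S (\<lambda>t. (t, g t))"
proof (rule abs_cont_on_dominated[OF assms zero_less_one])
  show "norm ((v, g v) - (u, g u)) \<le> 1 * (norm (g v - g u) + (v - u))" if "u \<le> v" for u v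
    using that norm_Pair_le[of "v - u" "g v - g u"] by simp
qed

lemma AE_lebesgue_translation:
  fixes P :: "'a::euclidean_space \<Rightarrow> bool"
  assumes "AE x in lebesgue. P x"
  shows "AE x in lebesgue. P (x - c)"
proof -
  obtain N where N: "N \<in> null_sets lebesgue" "{x. \<not> P x} \<subseteq> N"
    using assms by (auto simp: eventually_ae_filter)
  then have "(+) c ` N \<in> null_sets lebesgue"
    using negligible_translation by (simp add: negligible_iff_null_sets[symmetric])
  moreover have "{x \<in> space lebesgue. \<not> P (x - c)} \<subseteq> (+) c ` N"
    using N(2) by (force intro: image_eqI[of _ _ "_ - c"])
  ultimately show ?thesis by (rule AE_I')
qed

section \<open>Flows\<close>

definition has_continuous_gradient :: "('a::real_inner \<Rightarrow> real) \<Rightarrow> ('a \<Rightarrow> 'a) \<Rightarrow> bool" where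
  "has_continuous_gradient V gV \<longleftrightarrow>
     (\<forall>x. (V has_derivative (\<lambda>h. gV x \<bullet> h)) (at x)) \<and> continuous_on UNIV gV"

lemma has_continuous_gradient_derivative:
  "has_continuous_gradient V gV \<Longrightarrow> (V has_derivative (\<lambda>h. gV x \<bullet> h)) (at x)"
  by (simp add: has_continuous_gradient_def)

lemma has_continuous_gradient_continuous_on:
  assumes "has_continuous_gradient V gV"
  shows "continuous_on S V" "continuous_on S gV"
  using assms unfolding has_continuous_gradient_def
  by (meson continuous_at_imp_continuous_on has_derivative_continuous continuous_on_subset subset_UNIV)+

lemma has_continuous_gradient_inner: "has_continuous_gradient (\<lambda>x. w \<bullet> x) (\<lambda>_. w)"
  by (auto simp: has_continuous_gradient_def intro!: derivative_eq_intros)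

lemma has_continuous_gradient_minus_time:
  assumes "has_continuous_gradient W gW"
  shows "has_continuous_gradient (\<lambda>p. W (snd p) - M * fst p)
    (\<lambda>p::real \<times> 'a::euclidean_space. (- M, gW (snd p)))"
  unfolding has_continuous_gradient_def
proof (intro conjI allI)
  fix p :: "real \<times> 'a"
  show "((\<lambda>p. W (snd p) - M * fst p) has_derivative (\<bullet>) (- M, gW (snd p))) (at p)"
    by (auto intro!: derivative_eq_intros has_derivative_compose[OF has_derivative_snd[OF has_derivative_ident]
          has_continuous_gradient_derivative[OF assms]] simp: inner_prod_def fun_eq_iff)
  show "continuous_on UNIV (\<lambda>p::real \<times> 'a. (- M, gW (snd p)))"
    by (intro continuous_intros
        continuous_on_compose2[OF has_continuous_gradient_continuous_on(2)[OF assms, of UNIV]]) auto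
qed

lemma has_continuous_gradient_exp_time:
  assumes "has_continuous_gradient V gV"
  shows "has_continuous_gradient (\<lambda>p. exp (c * fst p) * V (snd p))
    (\<lambda>p::real \<times> 'a::euclidean_space. exp (c * fst p) *\<^sub>R (c * V (snd p), gV (snd p)))"
  unfolding has_continuous_gradient_def
proof (intro conjI allI)
  fix p :: "real \<times> 'a"
  show "((\<lambda>p. exp (c * fst p) * V (snd p)) has_derivative
      (\<bullet>) (exp (c * fst p) *\<^sub>R (c * V (snd p), gV (snd p)))) (at p)"
    by (auto intro!: derivative_eq_intros has_derivative_compose[OF has_derivative_snd[OF has_derivative_ident]
          has_continuous_gradient_derivative[OF assms]] simp: inner_prod_def fun_eq_iff algebra_simps)
  show "continuous_on UNIV (\<lambda>p::real \<times> 'a. exp (c * fst p) *\<^sub>R (c * V (snd p), gV (snd p)))"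
    by (intro continuous_intros
        continuous_on_compose2[OF has_continuous_gradient_continuous_on(1)[OF assms, of UNIV]]
        continuous_on_compose2[OF has_continuous_gradient_continuous_on(2)[OF assms, of UNIV]]) auto
qed

lemma has_continuous_gradient_lipschitz_on:
  fixes V :: "'a::euclidean_space \<Rightarrow> real"
  assumes gradient: "has_continuous_gradient V gV" and "bounded S"
  obtains M where "M-lipschitz_on S V"
proof -
  obtain r where r: "S \<subseteq> cball 0 r" using \<open>bounded S\<close> by (auto simp: bounded_iff subset_eq)
  have "compact (gV ` cball 0 r)"
    by (intro compact_continuous_image has_continuous_gradient_continuous_on[OF gradient] compact_cball)
  then obtain M where M: "M > 0" "\<forall>z\<in>gV ` cball 0 r. norm z \<le> M"
    using compact_imp_bounded bounded_pos by metis
  have "M-lipschitz_on (cball 0 r) V"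
  proof (rule bounded_derivative_imp_lipschitz)
    show "(V has_derivative (\<lambda>h. gV z \<bullet> h)) (at z within cball 0 r)" for z
      using has_continuous_gradient_derivative[OF gradient] by (rule has_derivative_at_withinI)
    show "onorm (\<lambda>h. gV z \<bullet> h) \<le> M" if "z \<in> cball 0 r" for z
    proof (rule onorm_le)
      fix h
      have "norm (gV z \<bullet> h) \<le> norm (gV z) * norm h" by (simp add: Cauchy_Schwarz_ineq2)
      also have "\<dots> \<le> M * norm h" using M(2) that by (intro mult_right_mono) auto
      finally show "norm (gV z \<bullet> h) \<le> M * norm h" .
    qed
  qed (use M(1) in auto)
  then show ?thesis using that r lipschitz_on_subset by blast
qed

definition flow_on :: "'a set \<Rightarrow> ('a \<Rightarrow> 'a) \<Rightarrow> real \<Rightarrow> real \<Rightarrow> (real \<Rightarrow> 'a::real_normed_vector) \<Rightarrow> bool" where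
  "flow_on C f a b y \<longleftrightarrow> abs_cont_on {a..b} y \<and> (\<forall>t\<in>{a<..<b}. y t \<in> C) \<and>
     (AE t in lebesgue. t \<in> {a<..<b} \<longrightarrow> (y has_vector_derivative f (y t)) (at t))"

lemma flow_on_subinterval:
  assumes "flow_on C f a b y" "a \<le> c" "d \<le> b"
  shows "flow_on C f c d y"
proof -
  have "AE t in lebesgue. t \<in> {c<..<d} \<longrightarrow> (y has_vector_derivative f (y t)) (at t)"
    using assms by (auto simp: flow_on_def elim!: eventually_mono)
  then show ?thesis
    using assms by (auto simp: flow_on_def intro: abs_cont_on_subset)
qed

lemma flow_on_degenerate:
  assumes "b \<le> a"
  shows "flow_on C f a b y"
proof -
  have "0-lipschitz_on {a} y" by (rule lipschitz_onI) auto
  then have "abs_cont_on {a..b} y"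
    using assms by (intro abs_cont_on_subset[OF lipschitz_imp_abs_cont_on, of 0 "{a}"]) auto
  then show ?thesis using assms by (simp add: flow_on_def)
qed

lemma flow_on_continuous_on: "flow_on C f a b y \<Longrightarrow> continuous_on {a..b} y"
  by (simp add: flow_on_def abs_cont_on_imp_continuous_on)

lemma flow_on_in_closed:
  assumes "flow_on C f a b y" "closed C" "a < b" "t \<in> {a..b}"
  shows "y t \<in> C"
proof -
  have "y ` closure {a<..<b} \<subseteq> C"
    using assms flow_on_continuous_on[OF assms(1)] by (intro image_closure_subset) (auto simp: flow_on_def)
  then show ?thesis using assms by auto
qed

lemma flow_on_shift:
  assumes "flow_on C f a b y"
  shows "flow_on C f (a + s) (b + s) (\<lambda>t. y (t - s))"
proof -
  have "AE t in lebesgue. t - s \<in> {a<..<b} \<longrightarrow> (y has_vector_derivative f (y (t - s))) (at (t - s))"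
    using assms by (intro AE_lebesgue_translation) (simp add: flow_on_def)
  moreover have "((\<lambda>t. y (t - s)) has_vector_derivative v) (at t)"
    if "(y has_vector_derivative v) (at (t - s))" for v t
  proof -
    have "((\<lambda>t. t - s) has_vector_derivative 1) (at t)"
      unfolding has_real_derivative_iff_has_vector_derivative[symmetric]
      by (auto intro!: derivative_eq_intros)
    then show ?thesis using vector_diff_chain_at[of "\<lambda>t. t - s" 1 t y v] that by (simp add: o_def)
  qed
  ultimately have "AE t in lebesgue. t \<in> {a + s<..<b + s} \<longrightarrow>
      ((\<lambda>t. y (t - s)) has_vector_derivative f (y (t - s))) (at t)"
    by (auto elim!: eventually_mono)
  then show ?thesis
    using assms by (auto simp: flow_on_def intro: abs_cont_on_shift)
qed

lemma flow_on_concat: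
  assumes y: "flow_on C f a b y" and z: "flow_on C f b c z" and "y b = z b" "y b \<in> C" "a \<le> b" "b \<le> c"
  shows "flow_on C f a c (\<lambda>t. if t \<le> b then y t else z t)" (is "flow_on C f a c ?yz")
  unfolding flow_on_def
proof (intro conjI)
  show "abs_cont_on {a..c} ?yz"
    using assms by (intro abs_cont_on_concat) (auto simp: flow_on_def)
  show "\<forall>t\<in>{a<..<c}. ?yz t \<in> C"
    using y z \<open>y b \<in> C\<close> by (auto simp: flow_on_def less_le)
  have left: "(?yz has_vector_derivative f (?yz t)) (at t)"
    if "(y has_vector_derivative f (y t)) (at t)" "t < b" for t
    using that has_vector_derivative_transform_within_open[OF _ open_lessThan, of y _ t b ?yz] by simp
  have right: "(?yz has_vector_derivative f (?yz t)) (at t)"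
    if "(z has_vector_derivative f (z t)) (at t)" "b < t" for t
    using that has_vector_derivative_transform_within_open[OF _ open_greaterThan, of z _ t b ?yz] by simp
  have "AE t in lebesgue. t \<noteq> b" by (intro AE_completion AE_lborel_singleton)
  moreover have "AE t in lebesgue. t \<in> {a<..<b} \<longrightarrow> (y has_vector_derivative f (y t)) (at t)"
    using y by (simp add: flow_on_def)
  moreover have "AE t in lebesgue. t \<in> {b<..<c} \<longrightarrow> (z has_vector_derivative f (z t)) (at t)"
    using z by (simp add: flow_on_def)
  ultimately show "AE t in lebesgue. t \<in> {a<..<c} \<longrightarrow> (?yz has_vector_derivative f (?yz t)) (at t)"
  proof eventually_elim
    case (elim t)
    then show ?case using left[of t] right[of t] by (cases t b rule: linorder_cases) auto
  qed
qed

lemma flow_on_nonincreasing: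
  fixes y :: "real \<Rightarrow> 'a::euclidean_space" and H :: "real \<times> 'a \<Rightarrow> real"
  assumes y: "flow_on C f a b y" and "a \<le> b" and gradient: "has_continuous_gradient H gH"
    and descent: "\<And>t. t \<in> {a<..<b} \<Longrightarrow> gH (t, y t) \<bullet> (1, f (y t)) \<le> 0"
  shows "H (b, y b) \<le> H (a, y a)"
proof (rule abs_cont_on_nonincreasing[OF _ \<open>a \<le> b\<close>, of "\<lambda>t. H (t, y t)"])
  have graph: "abs_cont_on {a..b} (\<lambda>t. (t, y t))"
    using y by (intro abs_cont_on_graph) (simp add: flow_on_def)
  then have "bounded ((\<lambda>t. (t, y t)) ` {a..b})"
    by (intro compact_imp_bounded compact_continuous_image abs_cont_on_imp_continuous_on) auto
  then obtain M where "M-lipschitz_on ((\<lambda>t. (t, y t)) ` {a..b}) H"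
    using has_continuous_gradient_lipschitz_on[OF gradient] by blast
  then show "abs_cont_on {a..b} (\<lambda>t. H (t, y t))"
    by (rule abs_cont_on_compose_lipschitz[OF graph])
  have chain_rule: "((\<lambda>t. H (t, y t)) has_real_derivative (gH (t, y t) \<bullet> (1, f (y t)))) (at t)"
    if "(y has_vector_derivative f (y t)) (at t)" for t
  proof -
    have "((\<lambda>t. (t, y t)) has_derivative (\<lambda>s. (s, s *\<^sub>R f (y t)))) (at t)"
      using that unfolding has_vector_derivative_def by (intro derivative_eq_intros) auto
    from has_derivative_compose[OF this has_continuous_gradient_derivative[OF gradient]]
    have "((\<lambda>t. H (t, y t)) has_derivative (\<lambda>s. gH (t, y t) \<bullet> (s, s *\<^sub>R f (y t)))) (at t)" .
    moreover have "(\<lambda>s. gH (t, y t) \<bullet> (s, s *\<^sub>R f (y t))) = (*) (gH (t, y t) \<bullet> (1, f (y t)))"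
      by (auto simp: fun_eq_iff inner_prod_def algebra_simps)
    ultimately show ?thesis unfolding has_field_derivative_def by simp
  qed
  have "AE t in lebesgue. t \<in> {a<..<b} \<longrightarrow> (y has_vector_derivative f (y t)) (at t)"
    using y by (simp add: flow_on_def)
  then show "AE t in lebesgue. t \<in> {a<..<b} \<longrightarrow> (\<exists>D\<le>0. ((\<lambda>t. H (t, y t)) has_real_derivative D) (at t))"
    by eventually_elim (use chain_rule descent in blast)
qed

lemma flow_on_growth_le:
  fixes y :: "real \<Rightarrow> 'a::euclidean_space"
  assumes "flow_on C f a b y" "a \<le> b" "has_continuous_gradient W gW"
    and "\<And>t. t \<in> {a<..<b} \<Longrightarrow> gW (y t) \<bullet> f (y t) \<le> M"
  shows "W (y b) - W (y a) \<le> M * (b - a)"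
proof -
  have "W (snd (b, y b)) - M * fst (b, y b) \<le> W (snd (a, y a)) - M * fst (a, y a)"
    by (rule flow_on_nonincreasing[OF assms(1,2) has_continuous_gradient_minus_time[OF assms(3)]])
      (use assms(4) in simp)
  then show ?thesis by (simp add: algebra_simps)
qed

lemma flow_on_exp_decay:
  fixes y :: "real \<Rightarrow> 'a::euclidean_space"
  assumes "flow_on C f a b y" "a \<le> b" "has_continuous_gradient V gV"
    and descent: "\<And>t. t \<in> {a<..<b} \<Longrightarrow> gV (y t) \<bullet> f (y t) \<le> - c * V (y t)"
  shows "exp (c * b) * V (y b) \<le> exp (c * a) * V (y a)"
proof -
  have "exp (c * fst (b, y b)) * V (snd (b, y b)) \<le> exp (c * fst (a, y a)) * V (snd (a, y a))"
  proof (rule flow_on_nonincreasing[OF assms(1,2) has_continuous_gradient_exp_time[OF assms(3)]])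
    fix t assume "t \<in> {a<..<b}"
    then have "exp (c * t) * (c * V (y t) + gV (y t) \<bullet> f (y t)) \<le> 0"
      using descent by (intro mult_nonneg_nonpos) fastforce+
    then show "(exp (c * fst (t, y t)) *\<^sub>R (c * V (snd (t, y t)), gV (snd (t, y t)))) \<bullet> (1, f (y t)) \<le> 0"
      by (simp add: algebra_simps)
  qed
  then show ?thesis by simp
qed

lemma flow_on_lipschitz:
  fixes y :: "real \<Rightarrow> 'a::euclidean_space"
  assumes y: "flow_on C f a b y" and field_bound: "\<And>t. t \<in> {a<..<b} \<Longrightarrow> norm (f (y t)) \<le> M" "M \<ge> 0"
  shows "M-lipschitz_on {a..b} y"
proof (rule lipschitz_on_leI[OF _ field_bound(2)])
  fix u v assume uv: "u \<in> {a..b}" "v \<in> {a..b}" "u \<le> v"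
  show "dist (y u) (y v) \<le> M * dist u v"
  proof (cases "y v = y u")
    case False
    define w where "w = y v - y u"
    have "w \<bullet> y v - w \<bullet> y u \<le> (norm w * M) * (v - u)"
    proof (rule flow_on_growth_le[OF flow_on_subinterval[OF y] _ has_continuous_gradient_inner])
      fix t assume t: "t \<in> {u<..<v}"
      have "w \<bullet> f (y t) \<le> norm w * norm (f (y t))" by (rule norm_cauchy_schwarz)
      also have "\<dots> \<le> norm w * M" using t uv by (intro mult_left_mono field_bound) auto
      finally show "w \<bullet> f (y t) \<le> norm w * M" .
    qed (use uv in auto)
    moreover have "w \<bullet> y v - w \<bullet> y u = norm w * norm w"
      by (simp add: w_def inner_diff_right[symmetric] power2_norm_eq_inner[symmetric] power2_eq_square)
    ultimately have "norm w * norm w \<le> norm w * (M * (v - u))" by (simp add: mult.assoc)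
    then show ?thesis using False uv by (simp add: w_def dist_norm norm_minus_commute)
  qed (use field_bound(2) in simp)
qed

section \<open>Hybrid time domains\<close>

definition jump_times :: "nat \<Rightarrow> (nat \<Rightarrow> real) \<Rightarrow> bool" where
  "jump_times J ts \<longleftrightarrow> ts 0 = 0 \<and> (\<forall>j\<le>J. ts j \<le> ts (Suc j))"

definition staircase :: "nat \<Rightarrow> (nat \<Rightarrow> real) \<Rightarrow> (real \<times> nat) set" where
  "staircase J ts = (\<Union>j\<in>{0..J}. {ts j .. ts (Suc j)} \<times> {j})"

definition htd_upto :: "(real \<times> nat) set \<Rightarrow> real \<Rightarrow> nat \<Rightarrow> (real \<times> nat) set" where
  "htd_upto E T J = E \<inter> ({0..T} \<times> {0..J})"

definition ordered_htd :: "(real \<times> nat) set \<Rightarrow> bool" where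
  "ordered_htd E \<longleftrightarrow> htd E \<and> (\<forall>t j t' j'. (t, j) \<in> E \<longrightarrow> (t', j') \<in> E \<longrightarrow> j < j' \<longrightarrow> t \<le> t')"

lemma mem_staircase [simp]: "(t, j) \<in> staircase J ts \<longleftrightarrow> j \<le> J \<and> ts j \<le> t \<and> t \<le> ts (Suc j)"
  by (auto simp: staircase_def)

lemma mem_htd_upto [simp]: "(t, j) \<in> htd_upto E T J \<longleftrightarrow> (t, j) \<in> E \<and> 0 \<le> t \<and> t \<le> T \<and> j \<le> J"
  by (auto simp: htd_upto_def)

lemma mem_tint [simp]: "t \<in> tint E j \<longleftrightarrow> (t, j) \<in> E"
  by (simp add: tint_def)

lemma tint_subset_iff: "tint E j \<subseteq> S \<longleftrightarrow> (\<forall>t. (t, j) \<in> E \<longrightarrow> t \<in> S)"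
  by (auto simp: tint_def)

lemma compact_htd_iff: "compact_htd E \<longleftrightarrow> (\<exists>J ts. jump_times J ts \<and> E = staircase J ts)"
  by (auto simp: compact_htd_def jump_times_def staircase_def)

lemma htd_iff:
  "htd E \<longleftrightarrow> (0, 0) \<in> E \<and> E \<subseteq> {0..} \<times> UNIV \<and> (\<forall>T J. (T, J) \<in> E \<longrightarrow> compact_htd (htd_upto E T J))"
  by (simp add: htd_def htd_upto_def)

lemma htd_origin: "htd E \<Longrightarrow> (0, 0) \<in> E"
  and htd_nonneg: "htd E \<Longrightarrow> (t, j) \<in> E \<Longrightarrow> 0 \<le> t"
  by (auto simp: htd_def)

lemma htd_staircaseE:
  assumes "htd E" "(T, J) \<in> E"
  obtains ts where "jump_times J ts" "ts (Suc J) = T" "htd_upto E T J = staircase J ts"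
proof -
  obtain J' ts where ts: "jump_times J' ts" "htd_upto E T J = staircase J' ts"
    using assms unfolding htd_iff compact_htd_iff by blast
  have "(T, J) \<in> staircase J' ts"
    using assms htd_nonneg[OF assms] unfolding ts(2)[symmetric] by simp
  moreover have "(ts (Suc J'), J') \<in> htd_upto E T J"
    using ts(1) unfolding ts(2) by (simp add: jump_times_def)
  ultimately have "J' = J" "ts (Suc J) = T" by auto
  then show ?thesis using that ts by blast
qed

lemma htd_interval_start:
  assumes E: "htd E" and in_dom: "(t, j) \<in> E"
  obtains s where "s \<le> t" "{s..t} \<subseteq> tint E j" "tint E j \<subseteq> {s..}"
    "j = 0 \<and> s = 0 \<or> (\<exists>i. j = Suc i \<and> (s, i) \<in> E)"
proof -
  obtain ts where ts: "jump_times j ts" "ts (Suc j) = t" "htd_upto E t j = staircase j ts"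
    using htd_staircaseE[OF E in_dom] .
  have mem: "(u, i) \<in> E" if "i \<le> j" "ts i \<le> u" "u \<le> ts (Suc i)" for u i
  proof -
    have "(u, i) \<in> htd_upto E t j" using that unfolding ts(3) by simp
    then show ?thesis by simp
  qed
  show ?thesis
  proof (rule that[of "ts j"])
    show "ts j \<le> t" using ts(1,2) by (auto simp: jump_times_def)
    moreover have "ts j \<le> u" if "(u, j) \<in> E" "u \<le> t" for u
    proof -
      have "(u, j) \<in> htd_upto E t j" using that htd_nonneg[OF E that(1)] by simp
      then show ?thesis unfolding ts(3) by simp
    qed
    ultimately show "tint E j \<subseteq> {ts j..}" by force
    show "{ts j..t} \<subseteq> tint E j" using mem[of j] ts(2) by auto
    show "j = 0 \<and> ts j = 0 \<or> (\<exists>i. j = Suc i \<and> (ts j, i) \<in> E)"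
      using ts(1) mem by (cases j) (auto simp: jump_times_def)
  qed
qed

lemma htd_interval:
  assumes "htd E" "(u, j) \<in> E" "(t, j) \<in> E"
  shows "{u..t} \<subseteq> tint E j"
proof -
  obtain s where "{s..t} \<subseteq> tint E j" "tint E j \<subseteq> {s..}"
    using htd_interval_start[OF assms(1,3)] .
  moreover have "u \<in> tint E j" using assms(2) by simp
  ultimately show ?thesis by fastforce
qed

lemma htd_jump_between:
  assumes "htd E" "(t', j') \<in> E" "j < j'"
  obtains s where "s \<le> t'" "(s, j) \<in> E" "(s, Suc j) \<in> E"
proof -
  obtain ts where ts: "jump_times j' ts" "htd_upto E t' j' = staircase j' ts"
    using htd_staircaseE[OF assms(1,2)] .
  have "(ts (Suc j), j) \<in> htd_upto E t' j'" "(ts (Suc j), Suc j) \<in> htd_upto E t' j'"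
    using ts(1) \<open>j < j'\<close> unfolding ts(2) jump_times_def by auto
  then show ?thesis using that[of "ts (Suc j)"] by simp
qed

lemma htd_upto_extend_flow:
  assumes E: "ordered_htd E" and "(s, J) \<in> E" and last_interval: "tint E J \<subseteq> {s..T}"
    and T': "s \<le> T'" "T' \<le> T"
  obtains ts where "jump_times J ts" "htd_upto (E \<union> {s..T} \<times> {J}) T' J = staircase J ts"
proof -
  have htd: "htd E" using E by (simp add: ordered_htd_def)
  obtain ts where ts: "jump_times J ts" "ts (Suc J) = s" "htd_upto E s J = staircase J ts"
    using htd_staircaseE[OF htd \<open>(s, J) \<in> E\<close>] .
  have mem: "(u, i) \<in> E \<and> 0 \<le> u \<and> u \<le> s \<longleftrightarrow> ts i \<le> u \<and> u \<le> ts (Suc i)" if "i \<le> J" for u i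
    using that mem_htd_upto[of u i E s J] unfolding ts(3) by simp
  have in_last: "s \<le> u \<and> u \<le> T" if "(u, J) \<in> E" for u using last_interval that by (auto simp: tint_def)
  have "ts J = s" using mem[of J "ts J"] in_last[of "ts J"] ts(1,2) by (auto simp: jump_times_def)
  define ts' where "ts' = ts(Suc J := T')"
  have "(u, i) \<in> htd_upto (E \<union> {s..T} \<times> {J}) T' J \<longleftrightarrow> (u, i) \<in> staircase J ts'" for u i
  proof (cases "i < J")
    case True
    moreover have "u \<le> s" if "(u, i) \<in> E"
      using E that \<open>(s, J) \<in> E\<close> True unfolding ordered_htd_def by blast
    ultimately show ?thesis using mem[of i u] T' by (auto simp: ts'_def)
  next
    case False
    then show ?thesis
      using in_last[of u] T' htd_nonneg[OF htd \<open>(s, J) \<in> E\<close>] \<open>ts J = s\<close> by (auto simp: ts'_def)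
  qed
  then have "htd_upto (E \<union> {s..T} \<times> {J}) T' J = staircase J ts'" unfolding set_eq_iff split_paired_All by blast
  moreover have "jump_times J ts'" using ts(1) \<open>ts J = s\<close> T' by (auto simp: jump_times_def ts'_def)
  ultimately show ?thesis using that by blast
qed

lemma htd_extend_flow:
  assumes E: "ordered_htd E" and "(s, J) \<in> E" and J_last: "snd ` E \<subseteq> {..J}"
    and last_interval: "tint E J \<subseteq> {s..T}"
  shows "htd (E \<union> {s..T} \<times> {J})" (is "htd ?E'")
  unfolding htd_iff
proof (intro conjI allI impI)
  have htd: "htd E" using E by (simp add: ordered_htd_def)
  have index_le: "j \<le> J" if "(t, j) \<in> E" for t j using J_last that by force
  show "(0, 0) \<in> ?E'" "?E' \<subseteq> {0..} \<times> UNIV"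
    using htd_origin[OF htd] htd_nonneg[OF htd] htd_nonneg[OF htd \<open>(s, J) \<in> E\<close>] by auto
  fix T' J' assume T'J': "(T', J') \<in> ?E'"
  show "compact_htd (htd_upto ?E' T' J')"
  proof (cases "J' = J")
    case False
    then have "(T', J') \<in> E" "J' < J" using T'J' index_le[of T' J'] by auto
    then have "htd_upto ?E' T' J' = htd_upto E T' J'" by auto
    then show ?thesis using htd \<open>(T', J') \<in> E\<close> by (simp add: htd_iff)
  next
    case True
    then have "s \<le> T'" "T' \<le> T" using T'J' last_interval by (auto simp: tint_subset_iff)
    then show ?thesis
      using htd_upto_extend_flow[OF E \<open>(s, J) \<in> E\<close> last_interval] unfolding compact_htd_iff True by metis
  qed
qed

lemma htd_extend_jump:
  assumes E: "htd E" and end_in_dom: "(T, J) \<in> E" and J_last: "snd ` E \<subseteq> {..J}"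
  shows "htd (insert (T, Suc J) E)" (is "htd ?E'")
  unfolding htd_iff
proof (intro conjI allI impI)
  have index_le: "j \<le> J" if "(t, j) \<in> E" for t j using J_last that by force
  show "(0, 0) \<in> ?E'" "?E' \<subseteq> {0..} \<times> UNIV"
    using htd_origin[OF E] htd_nonneg[OF E] end_in_dom by auto
  fix T' J' assume T'J': "(T', J') \<in> ?E'"
  show "compact_htd (htd_upto ?E' T' J')"
  proof (cases "J' = Suc J")
    case False
    then have "(T', J') \<in> E" "J' \<le> J" using T'J' index_le[of T' J'] by auto
    then have "htd_upto ?E' T' J' = htd_upto E T' J'" by auto
    then show ?thesis using E \<open>(T', J') \<in> E\<close> by (simp add: htd_iff)
  next
    case True
    then have "T' = T" using T'J' index_le[of T' J'] by auto
    obtain ts where ts: "jump_times J ts" "ts (Suc J) = T" "htd_upto E T J = staircase J ts"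
      using htd_staircaseE[OF E end_in_dom] .
    define ts' where "ts' = ts(Suc (Suc J) := T)"
    have "(u, i) \<in> htd_upto ?E' T (Suc J) \<longleftrightarrow> (u, i) \<in> staircase (Suc J) ts'" for u i
    proof (cases "i \<le> J")
      case True
      then show ?thesis using mem_htd_upto[of u i E T J] unfolding ts(3) by (auto simp: ts'_def)
    next
      case False
      then show ?thesis using ts(2) index_le[of u i] htd_nonneg[OF E end_in_dom] by (auto simp: ts'_def)
    qed
    then have "htd_upto ?E' T' J' = staircase (Suc J) ts'"
      unfolding True \<open>T' = T\<close> set_eq_iff split_paired_All by blast
    moreover have "jump_times (Suc J) ts'" using ts(1,2) by (auto simp: jump_times_def ts'_def le_Suc_eq)
    ultimately show ?thesis unfolding compact_htd_iff by blast
  qed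
qed

lemma incomplete_htd_last_interval:
  assumes E: "htd E" and "\<not> complete_dom E"
  obtains J s T where "snd ` E \<subseteq> {..J}" "(s, J) \<in> E" "s \<le> T"
    "{s..<T} \<subseteq> tint E J" "tint E J \<subseteq> {s..T}"
proof -
  obtain B where hybrid_time_less: "\<And>t j. (t, j) \<in> E \<Longrightarrow> t + real j < B"
    using assms(2) unfolding complete_dom_def by (fastforce simp: not_le)
  have "j \<le> nat \<lceil>B\<rceil>" if "(t, j) \<in> E" for t j
    using hybrid_time_less[OF that] htd_nonneg[OF E that] by linarith
  then have "snd ` E \<subseteq> {..nat \<lceil>B\<rceil>}" by force
  then have finite_indices: "finite (snd ` E)" by (rule finite_subset) simp
  define J where "J = Max (snd ` E)"
  have J_last: "snd ` E \<subseteq> {..J}" unfolding J_def using Max_ge[OF finite_indices] by blast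
  have "J \<in> snd ` E" unfolding J_def using finite_indices htd_origin[OF E] by (intro Max_in) auto
  then obtain t where t: "(t, J) \<in> E" by auto
  then obtain s where s: "s \<le> t" "{s..t} \<subseteq> tint E J" "tint E J \<subseteq> {s..}"
    by (rule htd_interval_start[OF E])
  then have start_in_dom: "(s, J) \<in> E" by auto
  define T where "T = Sup (tint E J)"
  have bdd: "bdd_above (tint E J)" using hybrid_time_less by (intro bdd_aboveI[of _ B]) fastforce
  have le_T: "u \<le> T" if "(u, J) \<in> E" for u
    unfolding T_def using that bdd by (intro cSup_upper) auto
  have "u \<in> tint E J" if u: "s \<le> u" "u < T" for u
  proof -
    have "tint E J \<noteq> {}" using start_in_dom mem_tint by blast
    then obtain v where "v \<in> tint E J" "u < v"
      using u(2) less_cSup_iff[OF _ bdd] unfolding T_def by blast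
    then show ?thesis using htd_interval[OF E start_in_dom, of v] u by (simp add: subset_eq)
  qed
  then have "{s..<T} \<subseteq> tint E J" by auto
  moreover have "tint E J \<subseteq> {s..T}" using s(3) le_T by force
  ultimately show ?thesis using J_last start_in_dom le_T[OF start_in_dom] by (intro that)
qed

section \<open>Solutions of hybrid systems\<close>

definition flow_piece :: "'a set \<Rightarrow> ('a \<Rightarrow> 'a) \<Rightarrow> real set \<Rightarrow> (real \<Rightarrow> 'a::real_normed_vector) \<Rightarrow> bool" where
  "flow_piece C f I y \<longleftrightarrow> loc_abs_cont_on I y \<and> (interior I \<noteq> {} \<longrightarrow> (\<forall>t\<in>interior I. y t \<in> C) \<and>
     (AE t in lebesgue. t \<in> I \<longrightarrow> (y has_vector_derivative f (y t)) (at t within I)))"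

lemma is_solution_iff:
  "is_solution C f D G E \<phi> \<longleftrightarrow> htd E \<and> \<phi> (0, 0) \<in> closure C \<union> D \<and>
     (\<forall>j. flow_piece C f (tint E j) (\<lambda>t. \<phi> (t, j))) \<and>
     (\<forall>t j. (t, j) \<in> E \<longrightarrow> (t, Suc j) \<in> E \<longrightarrow> \<phi> (t, j) \<in> D \<and> \<phi> (t, Suc j) \<in> G (\<phi> (t, j)))"
  unfolding is_solution_def hybrid_arc_def flow_piece_def by blast

lemma flow_piece_interior:
  assumes y: "flow_piece C f I y" and "{a<..<b} \<subseteq> I"
  shows "\<forall>t\<in>{a<..<b}. y t \<in> C"
    and "AE t in lebesgue. t \<in> {a<..<b} \<longrightarrow> (y has_vector_derivative f (y t)) (at t)"
proof -
  have in_interior: "{a<..<b} \<subseteq> interior I" using assms(2) by (intro interior_maximal) auto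
  show "\<forall>t\<in>{a<..<b}. y t \<in> C" using y in_interior unfolding flow_piece_def by blast
  show "AE t in lebesgue. t \<in> {a<..<b} \<longrightarrow> (y has_vector_derivative f (y t)) (at t)"
  proof (cases "{a<..<b} = {}")
    case False
    then have "AE t in lebesgue. t \<in> I \<longrightarrow> (y has_vector_derivative f (y t)) (at t within I)"
      using y in_interior unfolding flow_piece_def by blast
    then show ?thesis
      by eventually_elim (use in_interior interior_subset at_within_interior in \<open>metis subsetD\<close>)
  qed (auto simp: set_eq_iff)
qed

lemma flow_piece_imp_flow_on:
  assumes "flow_piece C f I y" "{a..b} \<subseteq> I"
  shows "flow_on C f a b y"
proof (cases "a \<le> b")
  case True
  then have "a \<in> I" "b \<in> I" using assms(2) by auto
  then have "abs_cont_on {a..b} y"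
    using assms(1) unfolding flow_piece_def loc_abs_cont_on_def by blast
  moreover have "{a<..<b} \<subseteq> I" using assms(2) by auto
  ultimately show ?thesis using flow_piece_interior[OF assms(1)] by (simp add: flow_on_def)
qed (simp add: flow_on_degenerate)

lemma flow_on_imp_flow_piece:
  assumes "flow_on C f a b y"
  shows "flow_piece C f {a..b} y"
proof -
  have "AE t in lebesgue. t \<noteq> a" "AE t in lebesgue. t \<noteq> b"
    by (intro AE_completion AE_lborel_singleton)+
  moreover have "AE t in lebesgue. t \<in> {a<..<b} \<longrightarrow> (y has_vector_derivative f (y t)) (at t)"
    using assms by (simp add: flow_on_def)
  ultimately have "AE t in lebesgue. t \<in> {a..b} \<longrightarrow> (y has_vector_derivative f (y t)) (at t within {a..b})"
    by eventually_elim (auto intro: has_vector_derivative_at_within)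
  moreover have "loc_abs_cont_on {a..b} y"
    using assms by (auto simp: flow_on_def loc_abs_cont_on_def intro: abs_cont_on_subset)
  ultimately show ?thesis using assms by (auto simp: flow_piece_def flow_on_def)
qed

lemma solution_htd: "is_solution C f D G E \<phi> \<Longrightarrow> htd E"
  by (simp add: is_solution_iff)

lemma solution_jumpD:
  assumes "is_solution C f D G E \<phi>" "(t, j) \<in> E" "(t, Suc j) \<in> E"
  shows "\<phi> (t, j) \<in> D" "\<phi> (t, Suc j) \<in> G (\<phi> (t, j))"
  using assms by (auto simp: is_solution_iff)

lemma solution_flow_on:
  assumes "is_solution C f D G E \<phi>" "{a..b} \<subseteq> tint E j"
  shows "flow_on C f a b (\<lambda>t. \<phi> (t, j))"
  using assms by (auto simp: is_solution_iff intro: flow_piece_imp_flow_on)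

lemma solution_induct [consumes 2, case_names init flow jump]:
  assumes sol: "is_solution C f D G E \<phi>" and in_dom: "(t, j) \<in> E"
    and init: "P 0 0"
    and flow: "\<And>a b j. a < b \<Longrightarrow> {a..b} \<subseteq> tint E j \<Longrightarrow> P a j \<Longrightarrow> P b j"
    and jump: "\<And>t j. (t, j) \<in> E \<Longrightarrow> (t, Suc j) \<in> E \<Longrightarrow> P t j \<Longrightarrow> P t (Suc j)"
  shows "P t j"
  using in_dom
proof (induction j arbitrary: t)
  case 0
  obtain s where "s \<le> t" "{s..t} \<subseteq> tint E 0" "s = 0"
    using htd_interval_start[OF solution_htd[OF sol] 0] by blast
  then show ?case using flow[of 0 t 0] init by (cases "t = 0") auto
next
  case (Suc j)
  obtain s where s: "s \<le> t" "{s..t} \<subseteq> tint E (Suc j)" "\<exists>i. Suc j = Suc i \<and> (s, i) \<in> E"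
    using htd_interval_start[OF solution_htd[OF sol] Suc.prems] by (metis nat.distinct(2))
  then have "(s, j) \<in> E" "(s, Suc j) \<in> E" by auto
  then have "P s (Suc j)" using Suc.IH jump by blast
  then show ?case using flow[of s t "Suc j"] s by (cases "s = t") auto
qed

lemma solution_in_flow_set:
  assumes sol: "is_solution C f D G E \<phi>" and "closed C" "D \<subseteq> C" "\<And>x. x \<in> D \<Longrightarrow> G x \<subseteq> C"
    and "(t, j) \<in> E"
  shows "\<phi> (t, j) \<in> C"
  using sol \<open>(t, j) \<in> E\<close>
proof (induction rule: solution_induct)
  case init
  then show ?case using assms by (auto simp: is_solution_iff)
next
  case (flow a b j)
  then show ?case using flow_on_in_closed[OF solution_flow_on[OF sol flow(2)] \<open>closed C\<close>, of b] by simp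
next
  case (jump t j)
  then show ?case using solution_jumpD[OF sol] assms(4) by blast
qed

text \<open>The definition of a hybrid time domain only constrains the part of \<open>E\<close> below each of its
  points and so admits branching domains such as \<open>[0,2] \<times> {0} \<union> {(1,1)}\<close>. They carry no solution
  if flowing from the jump set is impossible.\<close>

lemma solution_ordered_htd:
  assumes sol: "is_solution C f D G E \<phi>"
    and no_flow: "\<And>y a b. a < b \<Longrightarrow> flow_on C f a b y \<Longrightarrow> y a \<notin> D"
  shows "ordered_htd E"
  unfolding ordered_htd_def
proof (intro conjI allI impI)
  show E: "htd E" using solution_htd[OF sol] .
  fix t j t' j' assume tj: "(t, j) \<in> E" "(t', j') \<in> E" "j < j'"
  then obtain s where s: "s \<le> t'" "(s, j) \<in> E" "(s, Suc j) \<in> E"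
    using htd_jump_between[OF E] by blast
  then have "flow_on C f s t (\<lambda>u. \<phi> (u, j))"
    using solution_flow_on[OF sol] htd_interval[OF E s(2) tj(1)] by blast
  then have "\<not> s < t" using no_flow solution_jumpD(1)[OF sol s(2,3)] by blast
  then show "t \<le> t'" using s(1) by simp
qed

lemma solution_extend_flow:
  assumes sol: "is_solution C f D G E \<phi>" and E: "ordered_htd E"
    and start_in_dom: "(s, J) \<in> E" and J_last: "snd ` E \<subseteq> {..J}" and last_interval: "tint E J \<subseteq> {s..T}"
    and y: "flow_on C f s T y" and y_eq: "\<And>u. (u, J) \<in> E \<Longrightarrow> y u = \<phi> (u, J)"
  shows "is_solution C f D G (E \<union> {s..T} \<times> {J}) (\<lambda>(t, j). if j = J then y t else \<phi> (t, j))"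
    (is "is_solution C f D G ?E' ?\<phi>'")
proof -
  have index_le: "j \<le> J" if "(t, j) \<in> E" for t j using J_last that by force
  have extends: "?\<phi>' p = \<phi> p" if "p \<in> E" for p using that y_eq by (auto split: prod.splits)
  have "flow_piece C f (tint ?E' j) (\<lambda>t. ?\<phi>' (t, j))" for j
  proof (cases "j = J")
    case True
    then have "tint ?E' j = {s..T}" using last_interval by (auto simp: tint_def)
    then show ?thesis using flow_on_imp_flow_piece[OF y] True by simp
  next
    case False
    then have "tint ?E' j = tint E j" by (auto simp: tint_def)
    then show ?thesis using sol False by (simp add: is_solution_iff)
  qed
  moreover have "?\<phi>' (t, j) \<in> D \<and> ?\<phi>' (t, Suc j) \<in> G (?\<phi>' (t, j))"
    if "(t, j) \<in> ?E'" "(t, Suc j) \<in> ?E'" for t j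
  proof -
    have "Suc j \<le> J" using that index_le by auto
    then have in_dom: "(t, j) \<in> E" using that by auto
    have succ_in_dom: "(t, Suc j) \<in> E"
    proof (cases "Suc j = J")
      case True
      have "t \<le> s" using E in_dom start_in_dom True unfolding ordered_htd_def by blast
      moreover have "s \<le> t" using that True last_interval by auto
      ultimately show ?thesis using start_in_dom True by simp
    qed (use that in auto)
    show ?thesis
      unfolding extends[OF in_dom] extends[OF succ_in_dom]
      using solution_jumpD[OF sol in_dom succ_in_dom] by blast
  qed
  moreover have "?\<phi>' (0, 0) \<in> closure C \<union> D"
    using extends[OF htd_origin[OF solution_htd[OF sol]]] sol by (simp add: is_solution_iff)
  ultimately show ?thesis
    using htd_extend_flow[OF E start_in_dom J_last last_interval] unfolding is_solution_iff by blast
qed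

lemma solution_extend_jump:
  assumes sol: "is_solution C f D G E \<phi>"
    and end_in_dom: "(T, J) \<in> E" and J_last: "snd ` E \<subseteq> {..J}"
    and g: "\<phi> (T, J) \<in> D" "g \<in> G (\<phi> (T, J))"
  shows "is_solution C f D G (insert (T, Suc J) E) (\<phi>((T, Suc J) := g))"
    (is "is_solution C f D G ?E' ?\<phi>'")
proof -
  have index_le: "j \<le> J" if "(t, j) \<in> E" for t j using J_last that by force
  have "(t, Suc J) \<notin> E" for t using index_le[of t "Suc J"] by auto
  then have extends: "?\<phi>' p = \<phi> p" if "p \<in> E" for p using that by (metis fun_upd_other)
  have "flow_piece C f (tint ?E' j) (\<lambda>t. ?\<phi>' (t, j))" for j
  proof (cases "j = Suc J")
    case True
    then have singleton: "tint ?E' j = {T..T}" using \<open>\<And>t. (t, Suc J) \<notin> E\<close> by (auto simp: tint_def)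
    show ?thesis unfolding singleton by (intro flow_on_imp_flow_piece flow_on_degenerate) simp
  next
    case False
    then have "tint ?E' j = tint E j" by (auto simp: tint_def)
    then show ?thesis using sol False by (simp add: is_solution_iff)
  qed
  moreover have "?\<phi>' (t, j) \<in> D \<and> ?\<phi>' (t, Suc j) \<in> G (?\<phi>' (t, j))"
    if t: "(t, j) \<in> ?E'" "(t, Suc j) \<in> ?E'" for t j
  proof -
    have in_dom: "(t, j) \<in> E" using t index_le[of t "Suc j"] by auto
    show ?thesis
    proof (cases "(t, Suc j) \<in> E")
      case True
      then show ?thesis
        unfolding extends[OF in_dom] extends[OF True] using solution_jumpD[OF sol in_dom] by blast
    next
      case False
      then have "t = T" "j = J" using t(2) by auto
      then show ?thesis using g by simp
    qed
  qed
  moreover have "?\<phi>' (0, 0) \<in> closure C \<union> D" using sol by (simp add: is_solution_iff)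
  ultimately show ?thesis
    using htd_extend_jump[OF solution_htd[OF sol] end_in_dom J_last] unfolding is_solution_iff by blast
qed

lemma solution_lipschitz_on:
  fixes \<phi> :: "real \<times> nat \<Rightarrow> 'a::euclidean_space"
  assumes sol: "is_solution C f D G E \<phi>" and field_bound: "\<And>p. p \<in> E \<Longrightarrow> norm (f (\<phi> p)) \<le> M"
  shows "M-lipschitz_on (tint E j) (\<lambda>t. \<phi> (t, j))"
proof (rule lipschitz_on_leI)
  show "0 \<le> M" using order_trans[OF norm_ge_zero field_bound[OF htd_origin[OF solution_htd[OF sol]]]] .
  fix u v assume uv: "u \<in> tint E j" "v \<in> tint E j" "u \<le> v"
  have subinterval: "{u..v} \<subseteq> tint E j" using htd_interval[OF solution_htd[OF sol]] uv by simp
  then have "M-lipschitz_on {u..v} (\<lambda>t. \<phi> (t, j))"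
    using \<open>0 \<le> M\<close>
    by (intro flow_on_lipschitz[OF solution_flow_on[OF sol subinterval]] field_bound) (auto simp: subset_eq)
  then show "dist (\<phi> (u, j)) (\<phi> (v, j)) \<le> M * dist u v"
    using uv by (auto dest: lipschitz_onD)
qed

section \<open>Maximal solutions\<close>

lemma maximal_solution_imp_solution: "maximal_solution C f D G E \<phi> \<Longrightarrow> is_solution C f D G E \<phi>"
  by (simp add: maximal_solution_def)

lemma maximal_solution_no_extension:
  assumes "maximal_solution C f D G E \<phi>" "is_solution C f D G E' \<phi>'" "E \<subseteq> E'"
    and "\<And>p. p \<in> E \<Longrightarrow> \<phi>' p = \<phi> p"
  shows "E' = E"
  using assms unfolding maximal_solution_def by blast

lemma maximal_solution_no_jump_from_end:
  assumes maximal: "maximal_solution C f D G E \<phi>"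
    and end_in_dom: "(T, J) \<in> E" and J_last: "snd ` E \<subseteq> {..J}"
    and end_in_D: "\<phi> (T, J) \<in> D"
  shows "G (\<phi> (T, J)) = {}"
proof (rule ccontr)
  assume "G (\<phi> (T, J)) \<noteq> {}"
  then obtain g where "g \<in> G (\<phi> (T, J))" by blast
  note extension =
    solution_extend_jump[OF maximal_solution_imp_solution[OF maximal] end_in_dom J_last end_in_D this]
  have "(T, Suc J) \<notin> E" using J_last by force
  moreover have "insert (T, Suc J) E = E"
    by (rule maximal_solution_no_extension[OF maximal extension]) (use \<open>(T, Suc J) \<notin> E\<close> in auto)
  ultimately show False by blast
qed

lemma maximal_solution_no_flow_from_end:
  assumes maximal: "maximal_solution C f D G E \<phi>" and E: "ordered_htd E"
    and end_in_dom: "(T, J) \<in> E" and J_last: "snd ` E \<subseteq> {..J}" and T_last: "tint E J \<subseteq> {..T}"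
    and "\<phi> (T, J) \<in> C" "T < T'"
  shows "\<not> (flow_on C f T T' z \<and> z T = \<phi> (T, J))"
proof
  assume z: "flow_on C f T T' z \<and> z T = \<phi> (T, J)"
  note sol = maximal_solution_imp_solution[OF maximal]
  obtain s where s: "s \<le> T" "{s..T} \<subseteq> tint E J" "tint E J \<subseteq> {s..}"
    by (rule htd_interval_start[OF solution_htd[OF sol] end_in_dom])
  have start_in_dom: "(s, J) \<in> E" using s(1,2) by (simp add: subset_eq)
  define yz where "yz t = (if t \<le> T then \<phi> (t, J) else z t)" for t
  have "flow_on C f s T' yz"
    unfolding yz_def using z s(1) \<open>\<phi> (T, J) \<in> C\<close> \<open>T < T'\<close>
    by (intro flow_on_concat[OF solution_flow_on[OF sol s(2)]]) auto
  moreover have "tint E J \<subseteq> {s..T'}" using s(3) T_last \<open>T < T'\<close> by fastforce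
  moreover have yz_eq: "yz u = \<phi> (u, J)" if "(u, J) \<in> E" for u
    using T_last that by (auto simp: yz_def tint_subset_iff)
  ultimately have extension:
    "is_solution C f D G (E \<union> {s..T'} \<times> {J}) (\<lambda>(t, j). if j = J then yz t else \<phi> (t, j))"
    using start_in_dom J_last by (intro solution_extend_flow[OF sol E])
  have "(T', J) \<notin> E" using T_last \<open>T < T'\<close> by (auto simp: tint_subset_iff)
  moreover have "E \<union> {s..T'} \<times> {J} = E"
    by (rule maximal_solution_no_extension[OF maximal extension]) (use yz_eq in \<open>auto split: prod.splits\<close>)
  moreover have "(T', J) \<in> E \<union> {s..T'} \<times> {J}" using s(1) \<open>T < T'\<close> by simp
  ultimately show False by simp
qed

lemma maximal_solution_last_interval_not_half_open:
  fixes \<phi> :: "real \<times> nat \<Rightarrow> 'a::euclidean_space"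
  assumes maximal: "maximal_solution C f D G E \<phi>" and E: "ordered_htd E"
    and field_bound: "\<And>p. p \<in> E \<Longrightarrow> norm (f (\<phi> p)) \<le> M"
    and J_last: "snd ` E \<subseteq> {..J}" and "s < T"
  shows "tint E J \<noteq> {s..<T}"
proof
  assume half_open: "tint E J = {s..<T}"
  note sol = maximal_solution_imp_solution[OF maximal]
  have "M-lipschitz_on {s..<T} (\<lambda>t. \<phi> (t, J))"
    unfolding half_open[symmetric] by (intro solution_lipschitz_on[OF sol] field_bound)
  then obtain y where y: "M-lipschitz_on {s..T} y" "\<forall>t\<in>{s..<T}. y t = \<phi> (t, J)"
    using lipschitz_extend_closure unfolding closure_atLeastLessThan[OF \<open>s < T\<close>, symmetric] by blast
  have piece: "flow_piece C f (tint E J) (\<lambda>t. \<phi> (t, J))" using sol by (simp add: is_solution_iff)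
  have interior_subset: "{s<..<T} \<subseteq> tint E J" unfolding half_open by auto
  have y_deriv: "(y has_vector_derivative f (y t)) (at t)"
    if "t \<in> {s<..<T}" "((\<lambda>u. \<phi> (u, J)) has_vector_derivative f (\<phi> (t, J))) (at t)" for t
    using that y(2) has_vector_derivative_transform_within_open[OF that(2) open_greaterThanLessThan, of s T y]
    by simp
  have "AE t in lebesgue. t \<in> {s<..<T} \<longrightarrow> (y has_vector_derivative f (y t)) (at t)"
    using flow_piece_interior(2)[OF piece interior_subset] by eventually_elim (use y_deriv in blast)
  then have "flow_on C f s T y"
    using flow_piece_interior(1)[OF piece interior_subset] y(2)
    by (auto simp: flow_on_def intro: lipschitz_imp_abs_cont_on[OF y(1)])
  moreover have mem: "(u, J) \<in> E \<longleftrightarrow> u \<in> {s..<T}" for u using half_open mem_tint by blast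
  ultimately have extension:
    "is_solution C f D G (E \<union> {s..T} \<times> {J}) (\<lambda>(t, j). if j = J then y t else \<phi> (t, j))"
    using J_last y(2) \<open>s < T\<close> half_open by (intro solution_extend_flow[OF sol E]) auto
  have "E \<union> {s..T} \<times> {J} = E"
    by (rule maximal_solution_no_extension[OF maximal extension]) (use mem y(2) in \<open>auto split: prod.splits\<close>)
  moreover have "(T, J) \<in> E \<union> {s..T} \<times> {J}" using \<open>s < T\<close> by simp
  ultimately show False using mem[of T] by simp
qed

section \<open>Exponential stability from a Lyapunov function\<close>

locale hybrid_system =
  fixes C D :: "'a::euclidean_space set" and f :: "'a \<Rightarrow> 'a" and G :: "'a \<Rightarrow> 'a set"
  assumes closed_C: "closed C" and D_subset_C: "D \<subseteq> C"
    and G_subset_C: "x \<in> D \<Longrightarrow> G x \<subseteq> C" and G_nonempty: "x \<in> D \<Longrightarrow> G x \<noteq> {}"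
    and continuous_on_f: "continuous_on C f"
    and local_flow: "x \<in> C - D \<Longrightarrow> \<exists>h>0. \<exists>y. flow_on C f 0 h y \<and> y 0 = x"
    and no_flow_from_D: "a < b \<Longrightarrow> flow_on C f a b y \<Longrightarrow> y a \<notin> D"
begin

lemma solution_in_C: "is_solution C f D G E \<phi> \<Longrightarrow> (t, j) \<in> E \<Longrightarrow> \<phi> (t, j) \<in> C"
  using solution_in_flow_set closed_C D_subset_C G_subset_C by blast

lemma solution_start_in_C: "is_solution C f D G E \<phi> \<Longrightarrow> \<phi> (0, 0) \<in> C"
  using solution_in_C htd_origin solution_htd by blast

lemma solution_ordered: "is_solution C f D G E \<phi> \<Longrightarrow> ordered_htd E"
  using solution_ordered_htd no_flow_from_D by blast

lemma maximal_solution_end_notin_domain: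
  assumes maximal: "maximal_solution C f D G E \<phi>"
    and J_last: "snd ` E \<subseteq> {..J}" and T_last: "tint E J \<subseteq> {..T}"
  shows "(T, J) \<notin> E"
proof
  assume end_in_dom: "(T, J) \<in> E"
  note sol = maximal_solution_imp_solution[OF maximal]
  have "\<phi> (T, J) \<notin> D"
    using maximal_solution_no_jump_from_end[OF maximal end_in_dom J_last] G_nonempty by blast
  then obtain h y where h: "h > 0" "flow_on C f 0 h y" "y 0 = \<phi> (T, J)"
    using local_flow solution_in_C[OF sol end_in_dom] by blast
  let ?z = "\<lambda>t. y (t - T)"
  have "flow_on C f T (T + h) ?z" using flow_on_shift[OF h(2), of T] by (simp add: add.commute)
  moreover have "\<not> (flow_on C f T (T + h) ?z \<and> ?z T = \<phi> (T, J))"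
    using h(1) solution_in_C[OF sol end_in_dom]
    by (intro maximal_solution_no_flow_from_end[OF maximal solution_ordered[OF sol] end_in_dom J_last T_last])
      auto
  ultimately show False using h(3) by simp
qed

lemma maximal_solution_complete:
  assumes maximal: "maximal_solution C f D G E \<phi>" and "bounded (\<phi> ` E)"
  shows "complete_dom E"
proof (rule ccontr)
  assume incomplete: "\<not> complete_dom E"
  note sol = maximal_solution_imp_solution[OF maximal]
  obtain J s T where J_last: "snd ` E \<subseteq> {..J}"
    and last_interval: "(s, J) \<in> E" "s \<le> T" "{s..<T} \<subseteq> tint E J" "tint E J \<subseteq> {s..T}"
    using incomplete_htd_last_interval[OF solution_htd[OF sol] incomplete] .
  have "(T, J) \<notin> E"
    using last_interval(4) by (intro maximal_solution_end_notin_domain[OF maximal J_last]) auto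
  then have "s < T" "T \<notin> tint E J" using last_interval(1,2) by (auto simp: le_less)
  moreover have "{s..<T} = {s..T} - {T}" by auto
  ultimately have "tint E J = {s..<T}" using last_interval(3,4) by blast
  moreover have "\<phi> ` E \<subseteq> C" using solution_in_C[OF sol] by auto
  then have "compact (f ` closure (\<phi> ` E))"
    using assms(2) closed_C
    by (intro compact_continuous_image continuous_on_subset[OF continuous_on_f] closure_minimal) auto
  then obtain M where "\<forall>x\<in>closure (\<phi> ` E). norm (f x) \<le> M"
    using compact_imp_bounded bounded_iff by (metis imageI)
  then have "norm (f (\<phi> p)) \<le> M" if "p \<in> E" for p using that closure_subset by blast
  ultimately show False
    using maximal_solution_last_interval_not_half_open[OF maximal solution_ordered[OF sol] _ J_last \<open>s < T\<close>]
    by blast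
qed

lemma jump_count_le:
  assumes sol: "is_solution C f D G E \<phi>" and in_dom: "(t, j) \<in> E" and gradient: "has_continuous_gradient W gW"
    and W_flow: "\<And>x. x \<in> C \<Longrightarrow> gW x \<bullet> f x \<le> r"
    and W_jump: "\<And>x g. x \<in> D \<Longrightarrow> g \<in> G x \<Longrightarrow> W g + 1 \<le> W x"
    and W_bounds: "W ` C \<subseteq> {l..u}"
  shows "real j \<le> u - l + r * t"
proof -
  have "W (\<phi> (t, j)) + real j \<le> W (\<phi> (0, 0)) + r * t"
    using sol in_dom
  proof (induction rule: solution_induct)
    case init
    then show ?case by simp
  next
    case (flow a b j)
    have "W (\<phi> (b, j)) - W (\<phi> (a, j)) \<le> r * (b - a)"
      using flow(1,2) solution_in_C[OF sol]
      by (intro flow_on_growth_le[OF solution_flow_on[OF sol flow(2)] _ gradient] W_flow) (auto simp: subset_eq)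
    then show ?case using flow(3) by (simp add: algebra_simps)
  next
    case (jump t j)
    then show ?case using W_jump[OF solution_jumpD[OF sol jump(1,2)]] by simp
  qed
  moreover have "W (\<phi> (0, 0)) \<le> u" "l \<le> W (\<phi> (t, j))"
    using W_bounds solution_start_in_C[OF sol] solution_in_C[OF sol in_dom] by auto
  ultimately show ?thesis by simp
qed

end

lemma continuous_on_last_le:
  fixes g :: "real \<Rightarrow> real"
  assumes "continuous_on {a..b} g" "a \<le> b" "g a \<le> c" "c < g b"
  obtains s where "a \<le> s" "s < b" "g s \<le> c" "\<forall>u\<in>{s<..b}. c < g u"
proof -
  define S where "S = {u \<in> {a..b}. g u \<le> c}"
  have "closed S"
    unfolding S_def using assms(1)
    by (intro continuous_on_closed_Collect_le continuous_on_const closed_atLeastAtMost)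
  moreover have bdd: "bdd_above S" by (rule bdd_above_mono[of "{a..b}"]) (auto simp: S_def)
  moreover have "a \<in> S" using assms by (simp add: S_def)
  ultimately have "Sup S \<in> S" by (intro closed_contains_Sup) auto
  moreover have "c < g u" if "u \<in> {Sup S<..b}" for u
  proof (rule ccontr)
    assume "\<not> c < g u"
    then have "u \<in> S" using that \<open>Sup S \<in> S\<close> by (auto simp: S_def)
    then show False using cSup_upper[OF _ bdd, of u] that by simp
  qed
  moreover have "Sup S \<noteq> b" using \<open>Sup S \<in> S\<close> assms(4) by (auto simp: S_def)
  ultimately show ?thesis using that[of "Sup S"] by (auto simp: S_def)
qed

lemma exp_decay_eventually_less:
  fixes d e lam :: real
  assumes "lam > 0" "e > 0"
  obtains M where "\<And>s. M \<le> s \<Longrightarrow> d * exp (- lam * s) < e"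
proof -
  have "LIM s at_top. - lam * s :> at_bot"
    using assms(1) by (intro filterlim_tendsto_neg_mult_at_bot[OF tendsto_const] filterlim_ident) simp
  then have "((\<lambda>s. d * exp (- lam * s)) \<longlongrightarrow> d * 0) at_top"
    by (intro tendsto_mult tendsto_const filterlim_compose[OF exp_at_bot])
  then have "\<forall>\<^sub>F s in at_top. d * exp (- lam * s) < e"
    using assms(2) by (intro order_tendstoD(2)) simp_all
  then show ?thesis using that by (auto simp: eventually_at_top_linorder)
qed

locale hybrid_lyapunov = hybrid_system C D f G
  for C D :: "'a::euclidean_space set" and f :: "'a \<Rightarrow> 'a" and G :: "'a \<Rightarrow> 'a set" +
  fixes V :: "'a \<Rightarrow> real" and gradV :: "'a \<Rightarrow> 'a" and A U :: "'a set" and k c1 c2 c3 P R :: real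
  assumes compact_A: "compact A" and A_nonempty: "A \<noteq> {}"
    and V_gradient: "has_continuous_gradient V gradV"
    and consts_pos: "k > 0" "c1 > 0" "c2 > 0" "c3 > 0" and R_nonneg: "0 \<le> R"
    and jump_count: "is_solution C f D G E \<phi> \<Longrightarrow> (t, j) \<in> E \<Longrightarrow> real j \<le> P + R * t"
    and U_nhd: "\<exists>r>0. \<forall>x\<in>C. infdist x A < r \<longrightarrow> x \<in> U"
    and V_lower: "x \<in> C \<Longrightarrow> c1 * infdist x A powr k \<le> V x"
    and V_upper: "x \<in> C \<Longrightarrow> V x \<le> c2 * infdist x A powr k"
    and V_flow: "x \<in> C \<Longrightarrow> x \<in> U \<Longrightarrow> gradV x \<bullet> f x \<le> - c3 * V x"
    and V_jump: "x \<in> D \<Longrightarrow> g \<in> G x \<Longrightarrow> V g \<le> V x"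
begin

abbreviation "sublevel c \<equiv> {x \<in> C. V x \<le> c}"

text \<open>Since \<open>t + j \<le> P + (1 + R) * t\<close>, the rate \<open>c3 / k\<close> in \<open>t\<close> becomes \<open>c3 / (k * (1 + R))\<close> in \<open>t + j\<close>,
  at the cost of the factor \<open>exp (decay_rate * P)\<close>.\<close>

definition decay_rate :: real where
  "decay_rate = c3 / (k * (1 + R))"

definition overshoot :: real where
  "overshoot = (c2 / c1) powr (1 / k) * exp (decay_rate * P)"

lemma decay_rate_pos: "decay_rate > 0" and overshoot_pos: "overshoot > 0"
  using consts_pos R_nonneg by (auto simp: decay_rate_def overshoot_def)

lemma V_nonneg: "x \<in> C \<Longrightarrow> 0 \<le> V x"
  using V_lower[of x] consts_pos by (meson mult_nonneg_nonneg order_trans less_imp_le powr_ge_zero)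

lemma infdist_le_if_V_le:
  assumes "x \<in> C" "V x \<le> c"
  shows "infdist x A \<le> (c / c1) powr (1 / k)"
proof -
  have "infdist x A powr k \<le> c / c1"
    using V_lower[OF assms(1)] assms(2) consts_pos by (simp add: field_simps)
  then have "(infdist x A powr k) powr (1 / k) \<le> (c / c1) powr (1 / k)"
    using consts_pos by (intro powr_mono2) auto
  then show ?thesis using consts_pos by (simp add: powr_powr infdist_nonneg)
qed

lemma bounded_sublevel: "bounded (sublevel c)"
proof (rule bounded_subset)
  have "(c / c1) powr (1 / k) + 1 > 0" by (simp add: add_nonneg_pos)
  then show "bounded {x. infdist x A \<le> (c / c1) powr (1 / k) + 1}"
    by (intro compact_imp_bounded compact_infdist_le A_nonempty compact_A)
  show "sublevel c \<subseteq> {x. infdist x A \<le> (c / c1) powr (1 / k) + 1}"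
    using infdist_le_if_V_le by fastforce
qed

lemma sublevel_subset_nhd: "\<exists>\<mu>>0. sublevel (c2 * \<mu> powr k) \<subseteq> U"
proof -
  obtain r where r: "r > 0" "\<And>x. x \<in> C \<Longrightarrow> infdist x A < r \<Longrightarrow> x \<in> U" using U_nhd by blast
  define q where "q = (c2 / c1) powr (1 / k)"
  define \<mu> where "\<mu> = r / (2 * q)"
  have "q > 0" using consts_pos by (simp add: q_def)
  then have \<mu>: "\<mu> > 0" "q * \<mu> < r" using r(1) by (auto simp: \<mu>_def)
  have "(c2 * \<mu> powr k / c1) powr (1 / k) = q * \<mu>"
    using consts_pos \<mu>(1) by (simp add: q_def powr_mult powr_powr powr_divide)
  then have "infdist x A < r" if "x \<in> C" "V x \<le> c2 * \<mu> powr k" for x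
    using infdist_le_if_V_le[OF that] \<mu>(2) by simp
  then show ?thesis using r(2) \<mu>(1) by blast
qed

text \<open>The set \<open>U\<close> need not be open, so near a point of \<open>U\<close> off the attractor only the sign of the
  derivative survives; on the attractor, \<open>U\<close> contains a neighbourhood.\<close>

lemma V_descent_nearby:
  assumes x: "x \<in> C" "x \<in> U"
  shows "\<exists>r>0. \<forall>x'\<in>C. dist x' x < r \<longrightarrow> gradV x' \<bullet> f x' \<le> 0"
proof (cases "infdist x A = 0")
  case True
  obtain r where r: "r > 0" "\<And>x. x \<in> C \<Longrightarrow> infdist x A < r \<Longrightarrow> x \<in> U" using U_nhd by blast
  have "gradV x' \<bullet> f x' \<le> 0" if x': "x' \<in> C" "dist x' x < r" for x'
  proof -
    have "infdist x' A < r" using infdist_triangle[of x' A x] x'(2) True by simp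
    then have "gradV x' \<bullet> f x' \<le> - c3 * V x'" using r(2) V_flow x'(1) by blast
    also have "\<dots> \<le> 0" using V_nonneg[OF x'(1)] consts_pos by simp
    finally show ?thesis .
  qed
  then show ?thesis using r(1) by blast
next
  case False
  then have "0 < c1 * infdist x A powr k" using consts_pos by simp
  then have "0 < V x" using V_lower[OF x(1)] by simp
  then have "gradV x \<bullet> f x < 0" using V_flow[OF x] consts_pos by (smt (verit) mult_pos_pos mult_minus_left)
  moreover have "continuous_on C (\<lambda>x. gradV x \<bullet> f x)"
    by (intro continuous_intros has_continuous_gradient_continuous_on[OF V_gradient] continuous_on_f)
  ultimately obtain r where "r > 0"
    "\<forall>x'\<in>C. dist x' x < r \<longrightarrow> dist (gradV x' \<bullet> f x') (gradV x \<bullet> f x) < - (gradV x \<bullet> f x)"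
    using x(1) unfolding continuous_on_iff by (metis neg_0_less_iff_less)
  moreover have "v \<le> 0" if "dist v w < - w" for v w :: real using that by (simp add: dist_real_def)
  ultimately show ?thesis by blast
qed

lemma flow_stays_in_sublevel:
  assumes y: "flow_on C f a b y" and "a < b" and sublevel_sub: "sublevel c \<subseteq> U" and V_start: "V (y a) \<le> c"
    and t: "t \<in> {a..b}"
  shows "V (y t) \<le> c"
proof (rule ccontr)
  assume exceeds: "\<not> V (y t) \<le> c"
  have y_in_C: "y u \<in> C" if "u \<in> {a..b}" for u using flow_on_in_closed[OF y closed_C \<open>a < b\<close> that] .
  have cont_y: "continuous_on {a..b} y" using flow_on_continuous_on[OF y] .
  have "continuous_on {a..t} (\<lambda>u. V (y u))"
    using t
    by (intro continuous_on_compose2[OF has_continuous_gradient_continuous_on(1)[OF V_gradient, of UNIV]]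
        continuous_on_subset[OF cont_y]) auto
  then obtain s where s: "a \<le> s" "s < t" "V (y s) \<le> c" and after: "\<forall>u\<in>{s<..t}. c < V (y u)"
    using continuous_on_last_le[of a t "\<lambda>u. V (y u)" c] V_start t exceeds by auto
  have s_in: "s \<in> {a..b}" using s t by auto
  then obtain r where r: "r > 0" "\<forall>x'\<in>C. dist x' (y s) < r \<longrightarrow> gradV x' \<bullet> f x' \<le> 0"
    using V_descent_nearby[of "y s"] sublevel_sub s(3) y_in_C by blast
  then obtain d where d: "d > 0" "\<forall>u\<in>{a..b}. dist u s < d \<longrightarrow> dist (y u) (y s) < r"
    using cont_y s_in unfolding continuous_on_iff by blast
  define u where "u = min t (s + d / 2)"
  have u: "s < u" "u \<le> t" "u < s + d" using s d(1) by (auto simp: u_def)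
  have "V (y u) - V (y s) \<le> 0 * (u - s)"
  proof (rule flow_on_growth_le[OF flow_on_subinterval[OF y] _ V_gradient])
    fix v assume "v \<in> {s<..<u}"
    then have "v \<in> {a..b}" "dist v s < d" using s t u by (auto simp: dist_real_def)
    then show "gradV (y v) \<bullet> f (y v) \<le> 0" using r(2) d(2) y_in_C by blast
  qed (use s t u in auto)
  moreover have "c < V (y u)" using after u(1,2) by simp
  ultimately show False using s(3) by simp
qed

lemma flow_V_decay:
  assumes y: "flow_on C f a b y" and "a < b" and sublevel_sub: "sublevel c \<subseteq> U" and "V (y a) \<le> c"
  shows "exp (c3 * b) * V (y b) \<le> exp (c3 * a) * V (y a)"
proof (rule flow_on_exp_decay[OF y _ V_gradient])
  fix t assume "t \<in> {a<..<b}"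
  then have t: "t \<in> {a..b}" by simp
  have "y t \<in> C" using flow_on_in_closed[OF y closed_C \<open>a < b\<close> t] .
  moreover have "V (y t) \<le> c" using flow_stays_in_sublevel[OF assms t] .
  ultimately show "gradV (y t) \<bullet> f (y t) \<le> - c3 * V (y t)" using sublevel_sub V_flow by blast
qed (use \<open>a < b\<close> in simp)

context
  fixes E \<phi> c
  assumes sol: "is_solution C f D G E \<phi>" and sub: "sublevel c \<subseteq> U" and start: "V (\<phi> (0, 0)) \<le> c"
begin

lemma exp_decay_le_start:
  assumes "(t, j) \<in> E"
  shows "exp (- c3 * t) * V (\<phi> (0, 0)) \<le> c"
proof -
  have "exp (- c3 * t) * V (\<phi> (0, 0)) \<le> 1 * V (\<phi> (0, 0))"
    using V_nonneg[OF solution_start_in_C[OF sol]] htd_nonneg[OF solution_htd[OF sol] assms] consts_pos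
    by (intro mult_right_mono) auto
  then show ?thesis using start by simp
qed

lemma solution_V_decay:
  assumes "(t, j) \<in> E"
  shows "V (\<phi> (t, j)) \<le> exp (- c3 * t) * V (\<phi> (0, 0))"
proof -
  have "exp (c3 * t) * V (\<phi> (t, j)) \<le> V (\<phi> (0, 0))"
    using sol assms
  proof (induction rule: solution_induct)
    case init
    then show ?case by simp
  next
    case (flow a b j)
    then have "V (\<phi> (a, j)) \<le> exp (- c3 * a) * V (\<phi> (0, 0))" by (simp add: exp_minus field_simps)
    also have "\<dots> \<le> c" using flow(1,2) by (intro exp_decay_le_start[of a j]) (simp add: subset_eq)
    finally show ?case
      using flow_V_decay[OF solution_flow_on[OF sol flow(2)] flow(1) sub] flow(3) by fastforce
  next
    case (jump t j)
    have "V (\<phi> (t, Suc j)) \<le> V (\<phi> (t, j))" using V_jump[OF solution_jumpD[OF sol jump(1,2)]] .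
    then have "exp (c3 * t) * V (\<phi> (t, Suc j)) \<le> exp (c3 * t) * V (\<phi> (t, j))" by simp
    then show ?case using jump(3) by (rule order_trans)
  qed
  then show ?thesis by (simp add: exp_minus field_simps)
qed

lemma solution_in_sublevel: "\<phi> ` E \<subseteq> sublevel c"
  using solution_in_C[OF sol] solution_V_decay exp_decay_le_start by force

lemma maximal_solution_from_sublevel_complete:
  assumes "maximal_solution C f D G E \<phi>"
  shows "complete_dom E"
  using maximal_solution_complete[OF assms] bounded_subset[OF bounded_sublevel solution_in_sublevel] .

lemma exp_time_le_exp_hybrid_time:
  assumes "(t, j) \<in> E"
  shows "exp (- (c3 / k) * t) \<le> exp (decay_rate * P) * exp (- decay_rate * (t + real j))"
proof -
  have "decay_rate * (t + real j) \<le> decay_rate * (P + (1 + R) * t)"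
    using jump_count[OF sol assms] decay_rate_pos by (intro mult_left_mono) (auto simp: algebra_simps)
  also have "\<dots> = decay_rate * P + c3 / k * t"
    using R_nonneg by (simp add: decay_rate_def distrib_left[of _ P])
  finally show ?thesis by (simp flip: exp_add)
qed

lemma solution_infdist_decay:
  assumes in_dom: "(t, j) \<in> E"
  shows "infdist (\<phi> (t, j)) A \<le> overshoot * exp (- decay_rate * (t + real j)) * infdist (\<phi> (0, 0)) A"
proof -
  let ?d = "infdist (\<phi> (0, 0)) A"
  have "V (\<phi> (t, j)) \<le> exp (- c3 * t) * (c2 * ?d powr k)"
    using solution_V_decay[OF in_dom] V_upper[OF solution_start_in_C[OF sol]]
    by (rule order_trans[OF _ mult_left_mono]) simp
  then have "infdist (\<phi> (t, j)) A \<le> (exp (- c3 * t) * (c2 * ?d powr k) / c1) powr (1 / k)"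
    by (rule infdist_le_if_V_le[OF solution_in_C[OF sol in_dom]])
  also have "\<dots> = (c2 / c1) powr (1 / k) * exp (- (c3 / k) * t) * ?d"
    using consts_pos infdist_nonneg[of "\<phi> (0, 0)" A]
    by (simp add: powr_mult powr_divide powr_powr exp_powr_real)
  also have "\<dots> \<le> (c2 / c1) powr (1 / k) * (exp (decay_rate * P) * exp (- decay_rate * (t + real j))) * ?d"
    by (intro mult_right_mono mult_left_mono exp_time_le_exp_hybrid_time in_dom infdist_nonneg) simp
  finally show ?thesis by (simp add: overshoot_def mult.assoc)
qed

end

theorem exponentially_stable: "exp_stable C f D G A"
proof -
  obtain \<mu> where \<mu>: "\<mu> > 0" "sublevel (c2 * \<mu> powr k) \<subseteq> U" using sublevel_subset_nhd by blast
  have V_start: "V (\<phi> (0, 0)) \<le> c2 * \<mu> powr k"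
    if "is_solution C f D G E \<phi>" "infdist (\<phi> (0, 0)) A \<le> \<mu>" for E \<phi>
  proof -
    have "V (\<phi> (0, 0)) \<le> c2 * infdist (\<phi> (0, 0)) A powr k" by (rule V_upper[OF solution_start_in_C[OF that(1)]])
    also have "\<dots> \<le> c2 * \<mu> powr k"
      using that(2) consts_pos infdist_nonneg by (intro mult_left_mono powr_mono2) auto
    finally show ?thesis .
  qed
  show ?thesis
    unfolding exp_stable_def
  proof (intro exI conjI allI impI)
    fix E \<phi> assume \<phi>: "maximal_solution C f D G E \<phi> \<and> infdist (\<phi> (0, 0)) A \<le> \<mu>"
    note sol = maximal_solution_imp_solution[OF conjunct1[OF \<phi>]]
    show "complete_dom E"
      using maximal_solution_from_sublevel_complete[OF sol \<mu>(2) V_start[OF sol]] \<phi> by blast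
    show "infdist (\<phi> (t, j)) A \<le> overshoot * exp (- decay_rate * (t + real j)) * infdist (\<phi> (0, 0)) A"
      if "(t, j) \<in> E" for t j
      using solution_infdist_decay[OF sol \<mu>(2) V_start[OF sol] that] \<phi> by blast
  qed (use overshoot_pos decay_rate_pos \<mu>(1) in auto)
qed

theorem sublevel_subset_basin:
  assumes sublevel_sub: "sublevel c \<subseteq> U"
  shows "sublevel c \<subseteq> basin C f D G A"
proof -
  have "complete_dom E \<and> (\<forall>\<epsilon>>0. \<exists>M. \<forall>t j. (t, j) \<in> E \<and> M \<le> t + real j \<longrightarrow> infdist (\<phi> (t, j)) A < \<epsilon>)"
    if maximal: "maximal_solution C f D G E \<phi>" and V_start: "V (\<phi> (0, 0)) \<le> c" for E \<phi>
  proof (intro conjI allI impI)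
    note sol = maximal_solution_imp_solution[OF maximal]
    show "complete_dom E" using maximal_solution_from_sublevel_complete[OF sol sublevel_sub V_start maximal] .
    fix \<epsilon> :: real assume "\<epsilon> > 0"
    then obtain M where M: "\<And>s. M \<le> s \<Longrightarrow> overshoot * infdist (\<phi> (0, 0)) A * exp (- decay_rate * s) < \<epsilon>"
      using exp_decay_eventually_less[OF decay_rate_pos] by blast
    have "infdist (\<phi> (t, j)) A < \<epsilon>" if "(t, j) \<in> E" "M \<le> t + real j" for t j
      using solution_infdist_decay[OF sol sublevel_sub V_start that(1)] M[OF that(2)] by (simp add: mult_ac)
    then show "\<exists>M. \<forall>t j. (t, j) \<in> E \<and> M \<le> t + real j \<longrightarrow> infdist (\<phi> (t, j)) A < \<epsilon>" by blast
  qed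
  then show ?thesis unfolding basin_def by blast
qed

end

section \<open>Local flows of Lipschitz vector fields\<close>

definition picard :: "('a::banach \<Rightarrow> 'a) \<Rightarrow> 'a \<Rightarrow> (real \<Rightarrow> 'a) \<Rightarrow> real \<Rightarrow> 'a" where
  "picard F x0 g t = x0 + integral {0..t} (\<lambda>s. F (g s))"

lemma picard_contraction:
  assumes lipschitz: "L-lipschitz_on UNIV F" and g: "continuous_on {0..t} g1" "continuous_on {0..t} g2"
    and "0 \<le> t" "t \<le> h" and close: "\<And>s. s \<in> {0..t} \<Longrightarrow> dist (g1 s) (g2 s) \<le> d"
  shows "dist (picard F x0 g1 t) (picard F x0 g2 t) \<le> L * h * d"
proof -
  have "0 \<le> L" using lipschitz_on_nonneg[OF lipschitz] .
  have "0 \<le> d" using order_trans[OF zero_le_dist close[of 0]] \<open>0 \<le> t\<close> by simp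
  have cont: "continuous_on {0..t} (\<lambda>s. F (g1 s))" "continuous_on {0..t} (\<lambda>s. F (g2 s))"
    using g by (auto intro: continuous_on_compose2[OF lipschitz_on_continuous_on[OF lipschitz]])
  have "dist (picard F x0 g1 t) (picard F x0 g2 t) = norm (integral {0..t} (\<lambda>s. F (g1 s) - F (g2 s)))"
    using cont by (simp add: picard_def dist_norm integral_diff integrable_continuous_real)
  also have "\<dots> \<le> (L * d) * (t - 0)"
  proof (rule integral_bound)
    fix s assume "s \<in> {0..t}"
    then have "L * dist (g1 s) (g2 s) \<le> L * d" using close \<open>0 \<le> L\<close> by (intro mult_left_mono) auto
    then show "norm (F (g1 s) - F (g2 s)) \<le> L * d"
      using lipschitz_onD[OF lipschitz, of "g1 s" "g2 s"] by (simp add: dist_norm)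
  qed (use \<open>0 \<le> t\<close> cont in \<open>auto intro!: continuous_on_diff\<close>)
  also have "\<dots> \<le> L * d * h" using \<open>0 \<le> L\<close> \<open>0 \<le> d\<close> \<open>t \<le> h\<close> by (intro mult_left_mono) auto
  finally show ?thesis by (simp add: mult_ac)
qed

lemma picard_fixpoint:
  assumes lipschitz: "L-lipschitz_on UNIV F" and "0 \<le> h" "L * h < 1"
  obtains z where "continuous_on {0..h} z" "\<And>t. t \<in> {0..h} \<Longrightarrow> z t = picard F x0 z t"
proof -
  have L_nonneg: "0 \<le> L" using lipschitz_on_nonneg[OF lipschitz] .
  have clamp: "clamp 0 h t \<in> {0..h}" for t using clamp_in_interval[of 0 h t] \<open>0 \<le> h\<close> by simp
  have "\<exists>g' :: real \<Rightarrow>\<^sub>C 'a. \<forall>t. g' t = picard F x0 g (clamp 0 h t)" for g :: "real \<Rightarrow>\<^sub>C 'a"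
  proof -
    have "continuous_on {0..h} (\<lambda>s. F (g s))"
      by (rule continuous_on_compose2[OF lipschitz_on_continuous_on[OF lipschitz]]) auto
    then have "continuous_on (cbox 0 h) (picard F x0 g)"
      unfolding picard_def[abs_def] cbox_interval
      by (intro continuous_intros indefinite_integral_continuous_1 integrable_continuous_real)
    then show ?thesis by (rule continuous_on_cbox_bcontfunE) blast
  qed
  then obtain \<Phi> :: "(real \<Rightarrow>\<^sub>C 'a) \<Rightarrow> (real \<Rightarrow>\<^sub>C 'a)" where \<Phi>: "\<And>g t. \<Phi> g t = picard F x0 g (clamp 0 h t)"
    by metis
  have "\<exists>!g. \<Phi> g = g"
  proof (rule banach_fix_type)
    show "0 \<le> L * h" "L * h < 1" using L_nonneg \<open>0 \<le> h\<close> \<open>L * h < 1\<close> by auto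
    have "dist (\<Phi> g1) (\<Phi> g2) \<le> L * h * dist g1 g2" for g1 g2
      using clamp by (intro dist_bound) (auto simp: \<Phi> intro!: picard_contraction[OF lipschitz] dist_bounded)
    then show "\<forall>g1 g2. dist (\<Phi> g1) (\<Phi> g2) \<le> L * h * dist g1 g2" by blast
  qed
  then obtain g where "\<Phi> g = g" by blast
  then have "g t = picard F x0 g t" if "t \<in> {0..h}" for t using \<Phi>[of g t] that by simp
  then show ?thesis using that[of g] by simp
qed

lemma vector_derivative_imp_abs_cont_on:
  fixes y :: "real \<Rightarrow> 'a::real_normed_vector"
  assumes y: "\<And>t. t \<in> {a..b} \<Longrightarrow> (y has_vector_derivative y' t) (at t within {a..b})"
    and "continuous_on {a..b} y'"
  shows "abs_cont_on {a..b} y"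
proof -
  have "bounded (y' ` {a..b})" by (intro compact_imp_bounded compact_continuous_image assms) auto
  then obtain L where L: "L > 0" "\<And>t. t \<in> {a..b} \<Longrightarrow> norm (y' t) \<le> L" by (auto simp: bounded_pos)
  have "L-lipschitz_on {a..b} y"
  proof (rule bounded_derivative_imp_lipschitz)
    show "(y has_derivative (\<lambda>s. s *\<^sub>R y' t)) (at t within {a..b})" if "t \<in> {a..b}" for t
      using y[OF that] by (simp add: has_vector_derivative_def)
    show "onorm (\<lambda>s. s *\<^sub>R y' t) \<le> L" if "t \<in> {a..b}" for t
      using L(2)[OF that] by (simp add: onorm_scaleR_left bounded_linear_ident onorm_id)
  qed (use L in auto)
  then show ?thesis by (rule lipschitz_imp_abs_cont_on)
qed

lemma lipschitz_imp_local_flow: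
  fixes F :: "'a::banach \<Rightarrow> 'a"
  assumes lipschitz: "L-lipschitz_on UNIV F"
  shows "\<exists>h>0. \<exists>y. flow_on UNIV F 0 h y \<and> y 0 = x"
proof -
  define h where "h = 1 / (L + 1)"
  have h: "h > 0" "L * h < 1" using lipschitz_on_nonneg[OF lipschitz] by (auto simp: h_def)
  obtain z where cont_z: "continuous_on {0..h} z" and z: "\<And>t. t \<in> {0..h} \<Longrightarrow> z t = picard F x z t"
    using picard_fixpoint[OF lipschitz, of h x] h by auto
  have cont_Fz: "continuous_on {0..h} (\<lambda>t. F (z t))"
    by (rule continuous_on_compose2[OF lipschitz_on_continuous_on[OF lipschitz] cont_z]) auto
  have deriv: "(z has_vector_derivative F (z t)) (at t within {0..h})" if "t \<in> {0..h}" for t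
  proof (rule has_vector_derivative_transform[OF that z])
    show "(picard F x z has_vector_derivative F (z t)) (at t within {0..h})"
      unfolding picard_def[abs_def] using integral_has_vector_derivative[OF cont_Fz that]
      by (auto intro!: derivative_eq_intros)
  qed
  then have "(z has_vector_derivative F (z t)) (at t)" if "t \<in> {0<..<h}" for t
    using that deriv[of t] at_within_Icc_at[of 0 t h] by simp
  moreover have "abs_cont_on {0..h} z"
    using deriv cont_Fz by (rule vector_derivative_imp_abs_cont_on)
  ultimately have "flow_on UNIV F 0 h z" by (simp add: flow_on_def)
  moreover have "z 0 = x" using z[of 0] h by (simp add: picard_def)
  ultimately show ?thesis using h(1) by blast
qed

section \<open>The closed-loop system\<close>

lemma sat1_eq: "u > 0 \<Longrightarrow> sat1 u s = max (- u) (min s u)"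
  by (auto simp: sat1_def sgn_if min_def max_def)

lemma satv_lipschitz:
  assumes "\<forall>i. ub $ i > 0"
  shows "1-lipschitz_on UNIV (satv ub)"
proof (rule lipschitz_onI)
  fix v w :: "real ^ 'a"
  have "norm (satv ub v - satv ub w) \<le> norm (v - w)"
  proof (rule norm_le_componentwise_cart)
    fix i
    have "ub $ i > 0" using assms by simp
    then show "norm ((satv ub v - satv ub w) $ i) \<le> norm ((v - w) $ i)"
      by (simp add: satv_def sat1_eq)
  qed
  then show "dist (satv ub v) (satv ub w) \<le> 1 * dist v w" by (simp add: dist_norm)
qed simp

lemma bounded_linear_closed_loop:
  "bounded_linear (Acl A B K)" "bounded_linear (Bcl B)" "bounded_linear (Kcl K)"
proof -
  note matrix = bounded_linear_compose[OF matrix_vector_mul_bounded_linear]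
  show "bounded_linear (Acl A B K)" unfolding Acl_def[abs_def]
    by (intro bounded_linear_Pair bounded_linear_sub matrix bounded_linear_fst bounded_linear_snd)
  show "bounded_linear (Bcl B)" unfolding Bcl_def[abs_def]
    by (intro bounded_linear_Pair matrix_vector_mul_bounded_linear bounded_linear_zero)
  show "bounded_linear (Kcl K)" unfolding Kcl_def[abs_def]
    by (intro bounded_linear_sub matrix bounded_linear_fst bounded_linear_snd)
qed

lemma fcl_lipschitz:
  fixes A :: "real^'n^'n" and B :: "real^'m^'n" and K :: "real^'n^'m"
  assumes "\<forall>i. ub $ i > 0"
  shows "\<exists>L. L-lipschitz_on UNIV (fcl A B K ub :: ((real^'n) \<times> (real^'n)) \<times> (real^'q) \<Rightarrow> _)"
proof -
  obtain a where lip_Acl: "a-lipschitz_on UNIV (Acl A B K)"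
    using bounded_linear.lipschitz_boundE[OF bounded_linear_closed_loop(1)] by blast
  obtain b where lip_Bcl: "b-lipschitz_on UNIV (Bcl B)"
    using bounded_linear.lipschitz_boundE[OF bounded_linear_closed_loop(2)] by blast
  obtain c where lip_Kcl: "c-lipschitz_on UNIV (Kcl K)"
    using bounded_linear.lipschitz_boundE[OF bounded_linear_closed_loop(3)] by blast
  have lip_dzv: "(1 + 1)-lipschitz_on UNIV (dzv ub)"
    unfolding dzv_def[abs_def] by (intro lipschitz_on_diff satv_lipschitz assms lipschitz_on_id)
  let ?F = "\<lambda>z. Acl A B K z + Bcl B (dzv ub (Kcl K z))"
  have lip_field: "(a + b * ((1 + 1) * c))-lipschitz_on UNIV ?F"
    by (intro lipschitz_on_add lip_Acl lipschitz_on_compose2[OF lipschitz_on_compose2[OF lip_Kcl]]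
        lipschitz_on_subset[OF lip_Bcl] lipschitz_on_subset[OF lip_dzv]) auto
  obtain e where lip_fst: "e-lipschitz_on UNIV (fst :: ((real^'n) \<times> (real^'n)) \<times> (real^'q) \<Rightarrow> _)"
    using bounded_linear.lipschitz_boundE[OF bounded_linear_fst] by blast
  note lipschitz_on_Pair[OF
      lipschitz_on_compose2[OF lip_fst lipschitz_on_subset[OF lip_field subset_UNIV]] lipschitz_on_constant]
  then show ?thesis unfolding fcl_def[abs_def] by blast
qed

lemma Tset_eq_cbox: "Tset T2 = cbox 0 T2"
  by (auto simp: Tset_def mem_box_cart)

lemma mem_Ccl [simp]: "x \<in> Ccl T2 \<longleftrightarrow> snd x \<in> Tset T2"
  by (cases x) (simp add: Ccl_def)

lemma mem_Dcl: "x \<in> Dcl T2 \<longleftrightarrow> snd x \<in> Tset T2 \<and> (\<exists>i. snd x $ i = 0)"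
  by (cases x) (auto simp: Dcl_def Dset_def)

lemma closed_Ccl: "closed (Ccl T2)"
  unfolding Ccl_def Tset_eq_cbox by (intro closed_Times closed_cbox closed_UNIV)

lemma Dcl_subset_Ccl: "Dcl T2 \<subseteq> Ccl T2"
  by (auto simp: mem_Dcl)

lemma GclE:
  assumes "g \<in> Gcl blk T1 T2 x"
  obtains i where "snd x \<in> Tset T2" "snd x $ i = 0" "T1 $ i \<le> snd g $ i" "snd g $ i \<le> T2 $ i"
    "\<forall>l. l \<noteq> i \<longrightarrow> snd g $ l = snd x $ l"
  using assms by (auto simp: Gcl_def Dset_def Ghat_def)

lemma Gcl_subset_Ccl:
  assumes "\<forall>i. 0 < T1 $ i"
  shows "Gcl blk T1 T2 x \<subseteq> Ccl T2"
proof
  fix g assume "g \<in> Gcl blk T1 T2 x"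
  then obtain i where i: "snd x \<in> Tset T2" "T1 $ i \<le> snd g $ i" "snd g $ i \<le> T2 $ i"
    "\<forall>l. l \<noteq> i \<longrightarrow> snd g $ l = snd x $ l"
    by (rule GclE)
  have "0 \<le> snd g $ l \<and> snd g $ l \<le> T2 $ l" for l
    using i assms[rule_format, of i] by (cases "l = i") (auto simp: Tset_def)
  then show "g \<in> Ccl T2" by (simp add: Tset_def)
qed

lemma Gcl_nonempty:
  assumes "\<forall>i. T1 $ i \<le> T2 $ i" "x \<in> Dcl T2"
  shows "Gcl blk T1 T2 x \<noteq> {}"
proof -
  obtain i where i: "snd x \<in> Dset T2 i" using assms(2) by (auto simp: Dcl_def)
  have "(\<chi> l. if l = i then T2 $ i else snd x $ l) \<in> Ghat T1 T2 i (snd x)"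
    using assms(1) by (simp add: Ghat_def)
  then show ?thesis using i unfolding Gcl_def by blast
qed

lemma compact_Acl_set: "compact (Acl_set T2)"
  unfolding Acl_set_def Tset_eq_cbox by (intro compact_Times compact_cbox) simp

lemma infdist_Acl_set:
  assumes "x \<in> Ccl T2"
  shows "infdist x (Acl_set T2) = norm (fst x)"
proof (rule antisym)
  have proj: "(0, snd x) \<in> Acl_set T2" using assms by (simp add: Acl_set_def)
  then have "infdist x (Acl_set T2) \<le> dist x (0, snd x)" by (rule infdist_le)
  then show "infdist x (Acl_set T2) \<le> norm (fst x)" by (cases x) (simp add: dist_Pair_Pair)
  have "norm (fst x) \<le> dist x a" if "a \<in> Acl_set T2" for a
    using dist_fst_le[of x a] that by (auto simp: Acl_set_def)
  then show "norm (fst x) \<le> infdist x (Acl_set T2)"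
    using proj unfolding infdist_def by (auto intro!: cINF_greatest)
qed

lemma closed_loop_flow_timer:
  fixes y :: "real \<Rightarrow> ((real^'n) \<times> (real^'n)) \<times> (real^'q)"
  assumes y: "flow_on C (fcl A B K ub) a b y" and "a \<le> b"
  shows "snd (y b) $ i = snd (y a) $ i - (b - a)"
proof -
  have "(0, axis i c) \<bullet> y b - (0, axis i c) \<bullet> y a \<le> - c * (b - a)" for c :: real
    by (rule flow_on_growth_le[OF y \<open>a \<le> b\<close> has_continuous_gradient_inner])
      (simp add: inner_prod_def inner_axis' fcl_def)
  from this[of 1] this[of "- 1"] show ?thesis
    by (simp add: inner_prod_def inner_axis' algebra_simps)
qed

lemma closed_loop_no_flow_from_Dcl:
  fixes y :: "real \<Rightarrow> ((real^'n) \<times> (real^'n)) \<times> (real^'q)"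
  assumes "a < b" and y: "flow_on (Ccl T2) (fcl A B K ub) a b y"
  shows "y a \<notin> Dcl T2"
proof
  assume "y a \<in> Dcl T2"
  then obtain i where i: "snd (y a) $ i = 0" by (auto simp: mem_Dcl)
  define m where "m = (a + b) / 2"
  have m: "a < m" "m < b" using \<open>a < b\<close> by (auto simp: m_def)
  have "snd (y m) $ i = snd (y a) $ i - (m - a)"
    using m by (intro closed_loop_flow_timer[OF flow_on_subinterval[OF y]]) auto
  then have "snd (y m) $ i < 0" using i m by simp
  moreover have "y m \<in> Ccl T2" using y m by (simp add: flow_on_def)
  then have "0 \<le> snd (y m) $ i" by (simp add: Tset_def)
  ultimately show False by simp
qed

lemma closed_loop_local_flow:
  fixes x :: "((real^'n) \<times> (real^'n)) \<times> (real^'q)"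
  assumes "\<forall>i. ub $ i > 0" and x: "x \<in> Ccl T2 - Dcl T2"
  shows "\<exists>h>0. \<exists>y. flow_on (Ccl T2) (fcl A B K ub) 0 h y \<and> y 0 = x"
proof -
  obtain L where L: "L-lipschitz_on UNIV (fcl A B K ub :: ((real^'n) \<times> (real^'n)) \<times> (real^'q) \<Rightarrow> _)"
    using fcl_lipschitz[OF assms(1)] by blast
  obtain h y where h: "h > 0" and y: "flow_on UNIV (fcl A B K ub) 0 h y" "y 0 = x"
    using lipschitz_imp_local_flow[OF L] by blast
  have \<tau>: "0 < snd x $ i" "snd x $ i \<le> T2 $ i" for i
    using x by (auto simp: mem_Dcl Tset_def less_le)
  define h' where "h' = Min (insert h (range (($) (snd x))))"
  have h': "0 < h'" "h' \<le> h" "\<And>i. h' \<le> snd x $ i"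
    using h \<tau> unfolding h'_def by (auto simp del: Min_insert intro: Min_le)
  have "y t \<in> Ccl T2" if t: "t \<in> {0<..<h'}" for t
  proof -
    have "snd (y t) $ i = snd x $ i - t" for i
      using closed_loop_flow_timer[OF flow_on_subinterval[OF y(1)], of 0 t i] t h'(2) y(2) by simp
    moreover have "0 \<le> snd x $ i - t \<and> snd x $ i - t \<le> T2 $ i" for i
      using t \<tau>(2)[of i] h'(3)[of i] by simp
    ultimately show ?thesis by (simp add: Tset_def)
  qed
  then have "flow_on (Ccl T2) (fcl A B K ub) 0 h' y"
    using flow_on_subinterval[OF y(1), of 0 h'] h'(2) by (simp add: flow_on_def)
  then show ?thesis using h'(1) y(2) by blast
qed

lemma hybrid_system_closed_loop:
  fixes blk :: "'n::finite \<Rightarrow> 'q::finite"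
  assumes "\<forall>i. ub $ i > 0" "\<forall>i. 0 < T1 $ i" "\<forall>i. T1 $ i \<le> T2 $ i"
  shows "hybrid_system (Ccl T2) (Dcl T2) (fcl A B K ub) (Gcl blk T1 T2)"
proof
  show "continuous_on (Ccl T2) (fcl A B K ub)"
    using fcl_lipschitz[OF assms(1)] by (meson lipschitz_on_continuous_on continuous_on_subset subset_UNIV)
  show "\<exists>h>0. \<exists>y. flow_on (Ccl T2) (fcl A B K ub) 0 h y \<and> y 0 = x"
    if "x \<in> Ccl T2 - Dcl T2" for x :: "((real^'n) \<times> (real^'n)) \<times> (real^'q)"
    using closed_loop_local_flow[OF assms(1) that] .
  show "y a \<notin> Dcl T2" if "a < b" "flow_on (Ccl T2) (fcl A B K ub) a b y"
    for a b and y :: "real \<Rightarrow> ((real^'n) \<times> (real^'n)) \<times> (real^'q)"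
    using closed_loop_no_flow_from_Dcl[OF that] .
qed (simp_all add: closed_Ccl Dcl_subset_Ccl Gcl_subset_Ccl[OF assms(2)] Gcl_nonempty[OF assms(3)] del: mem_Ccl)

lemma Gcl_weighted_timer_sum:
  assumes T1: "\<forall>i. 0 < T1 $ i" and g: "g \<in> Gcl blk T1 T2 x"
  shows "(\<Sum>l\<in>UNIV. snd x $ l / T1 $ l) + 1 \<le> (\<Sum>l\<in>UNIV. snd g $ l / T1 $ l)"
proof -
  obtain i where i: "snd x $ i = 0" "T1 $ i \<le> snd g $ i" "\<forall>l. l \<noteq> i \<longrightarrow> snd g $ l = snd x $ l"
    by (rule GclE[OF g])
  have "(\<Sum>l\<in>UNIV - {i}. snd g $ l / T1 $ l) = (\<Sum>l\<in>UNIV - {i}. snd x $ l / T1 $ l)"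
    using i(3) by (intro sum.cong) auto
  moreover have "1 \<le> snd g $ i / T1 $ i" using i(2) T1 by simp
  ultimately show ?thesis using i(1) by (simp add: sum.remove[of UNIV i])
qed

lemma closed_loop_jump_count:
  fixes \<phi> :: "real \<times> nat \<Rightarrow> ((real^'n) \<times> (real^'n)) \<times> (real^'q)"
  assumes "\<forall>i. ub $ i > 0" and T1: "\<forall>i. 0 < T1 $ i" and "\<forall>i. T1 $ i \<le> T2 $ i"
    and sol: "is_solution (Ccl T2) (fcl A B K ub) (Dcl T2) (Gcl blk T1 T2) E \<phi>" and in_dom: "(t, j) \<in> E"
  shows "real j \<le> (\<Sum>i\<in>UNIV. T2 $ i / T1 $ i) + (\<Sum>i\<in>UNIV. 1 / T1 $ i) * t"
proof -
  interpret hybrid_system "Ccl T2" "Dcl T2" "fcl A B K ub" "Gcl blk T1 T2"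
    using hybrid_system_closed_loop assms(1-3) .
  define w :: "((real^'n) \<times> (real^'n)) \<times> (real^'q)" where "w = (0, - (\<chi> i. 1 / T1 $ i))"
  have w: "w \<bullet> x = - (\<Sum>i\<in>UNIV. snd x $ i / T1 $ i)" for x
    by (simp add: w_def inner_prod_def inner_vec_def sum_negf)
  have "real j \<le> 0 - (- (\<Sum>i\<in>UNIV. T2 $ i / T1 $ i)) + (\<Sum>i\<in>UNIV. 1 / T1 $ i) * t"
  proof (rule jump_count_le[OF sol in_dom has_continuous_gradient_inner])
    show "w \<bullet> fcl A B K ub x \<le> (\<Sum>i\<in>UNIV. 1 / T1 $ i)" for x
      by (simp add: w fcl_def sum_negf)
    show "w \<bullet> g + 1 \<le> w \<bullet> x" if "g \<in> Gcl blk T1 T2 x" for x g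
      using Gcl_weighted_timer_sum[OF T1 that] by (simp add: w)
    have "0 \<le> (\<Sum>i\<in>UNIV. snd x $ i / T1 $ i)" "(\<Sum>i\<in>UNIV. snd x $ i / T1 $ i) \<le> (\<Sum>i\<in>UNIV. T2 $ i / T1 $ i)"
      if "x \<in> Ccl T2" for x
      using that T1 by (auto simp: Tset_def less_imp_le intro!: sum_nonneg sum_mono divide_right_mono)
    then show "(\<bullet>) w ` Ccl T2 \<subseteq> {- (\<Sum>i\<in>UNIV. T2 $ i / T1 $ i)..0}" by (auto simp: w simp del: mem_Ccl)
  qed
  then show ?thesis by simp
qed

lemma Acl_set_neighbourhood:
  assumes "0 \<in> interior U"
  shows "\<exists>r>0. \<forall>x\<in>Ccl T2. infdist x (Acl_set T2) < r \<longrightarrow> x \<in> U \<times> Tset T2"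
proof -
  obtain r where "r > 0" "ball 0 r \<subseteq> U" using assms by (meson mem_interior)
  then show ?thesis
    by (intro exI[of _ r]) (auto simp: infdist_Acl_set subset_eq mem_Times_iff)
qed

theorem theorem2:
  fixes blk :: "'n::{finite,linorder} \<Rightarrow> 'q::{finite,linorder}"
    and A :: "((real, 'n) vec, 'n) vec" and B :: "((real, 'm::finite) vec, 'n) vec" and K :: "((real, 'n) vec, 'm) vec" and ub :: "(real, 'm) vec"
    and T1 T2 :: "(real, 'q) vec"
    and V :: "(((real, 'n) vec) \<times> ((real, 'n) vec)) \<times> ((real, 'q) vec) \<Rightarrow> real"
    and gradV :: "(((real, 'n) vec) \<times> ((real, 'n) vec)) \<times> ((real, 'q) vec) \<Rightarrow> (((real, 'n) vec) \<times> ((real, 'n) vec)) \<times> ((real, 'q) vec)"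
    and k c1 c2 c3 :: real
    and U :: "(((real, 'n) vec) \<times> ((real, 'n) vec)) set"
  assumes blk_surj: "surj blk" and blk_mono: "mono blk"
    and ub_pos: "\<forall>i. ub $ i > 0"
    and T1_pos: "\<forall>i. 0 < T1 $ i" and T1_le_T2: "\<forall>i. T1 $ i \<le> T2 $ i"
    and V_deriv: "\<forall>x. (V has_derivative (\<lambda>h. gradV x \<bullet> h)) (at x)"
    and gradV_cont: "continuous_on UNIV gradV"
    and consts_pos: "k > 0" "c1 > 0" "c2 > 0" "c3 > 0"
    and U_nhd: "0 \<in> interior U"
    and V_bounds: "\<forall>x\<in>Ccl T2. c1 * infdist x (Acl_set T2) powr k \<le> V x \<and>
                               V x \<le> c2 * infdist x (Acl_set T2) powr k"
    and V_flow: "\<forall>x\<in>U \<times> Tset T2. gradV x \<bullet> fcl A B K ub x \<le> - c3 * V x"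
    and V_jump: "\<forall>x\<in>Dcl T2. \<forall>g\<in>Gcl blk T1 T2 x. V g - V x \<le> 0"
  shows "exp_stable (Ccl T2) (fcl A B K ub) (Dcl T2) (Gcl blk T1 T2) (Acl_set T2) \<and>
         (\<forall>c. {x \<in> Ccl T2. V x \<le> c} \<subseteq> U \<times> Tset T2 \<longrightarrow>
              {x \<in> Ccl T2. V x \<le> c} \<subseteq> basin (Ccl T2) (fcl A B K ub) (Dcl T2) (Gcl blk T1 T2) (Acl_set T2))"
proof -
  have "0 \<in> Tset T2" using T1_pos T1_le_T2 by (auto simp: Tset_def intro: less_imp_le less_le_trans)
  interpret hybrid_system "Ccl T2" "Dcl T2" "fcl A B K ub" "Gcl blk T1 T2"
    using hybrid_system_closed_loop ub_pos T1_pos T1_le_T2 .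
  interpret hybrid_lyapunov "Ccl T2" "Dcl T2" "fcl A B K ub" "Gcl blk T1 T2" V gradV "Acl_set T2" "U \<times> Tset T2"
    k c1 c2 c3 "\<Sum>i\<in>UNIV. T2 $ i / T1 $ i" "\<Sum>i\<in>UNIV. 1 / T1 $ i"
  proof
    show "Acl_set T2 \<noteq> {}" using \<open>0 \<in> Tset T2\<close> by (auto simp: Acl_set_def)
    show "has_continuous_gradient V gradV" using V_deriv gradV_cont by (simp add: has_continuous_gradient_def)
    show "0 \<le> (\<Sum>i\<in>UNIV. 1 / T1 $ i)" using T1_pos by (intro sum_nonneg) (simp add: less_imp_le)
    show "gradV x \<bullet> fcl A B K ub x \<le> - c3 * V x" if "x \<in> U \<times> Tset T2" for x using V_flow that by blast
    show "V g \<le> V x" if "x \<in> Dcl T2" "g \<in> Gcl blk T1 T2 x" for x g using V_jump that by fastforce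
  qed (use compact_Acl_set closed_loop_jump_count[OF ub_pos T1_pos T1_le_T2] Acl_set_neighbourhood[OF U_nhd]
      consts_pos V_bounds in blast)+
  show ?thesis using exponentially_stable sublevel_subset_basin by blast
qed

end
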